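(* Let $F=\mathbb Q(\sqrt5)$. The elements $\sigma,\nu,\tau$ generate $\Gamma^*$, and a complete set of defining relations for $\Gamma^*$ in these generators is (i$'$) $\sigma^2=1$; (ii$'$) $(\sigma\tau)^3=1$; (iii$'$) $(\sigma\nu)^2=1$; (iv$'$) $\tau\nu\tau\nu^{-1}=\nu\tau\nu^{-1}\tau$; (v$'$) $\nu^2\tau\nu^{-2}=\tau\nu\tau\nu^{-1}$.
   Context: Let $F=\mathbb Q(\sqrt5)$, $\mathcal O_F$ its ring of integers, $E_F$ its unit group and $\epsilon=(1+\sqrt5)/2$. Let $Z=\{uI_2:u\in E_F\}$, $\bar\Gamma^*=\{\gamma\in\mathrm{GL}(2,\mathcal O_F):\det\gamma=\epsilon^n,n\in\mathbb Z\}$ and $\Gamma^*=Z\bar\Gamma^*/Z\subset\mathrm{PGL}(2,\mathcal O_F)$. Let $\sigma,\nu,\tau\in\Gamma^*$ be the images of $\begin{pmatrix}0&1\\-1&0\end{pmatrix}$, $\begin{pmatrix}\epsilon&0\\0&1\end{pmatrix}$, $\begin{pmatrix}1&1\\0&1\end{pmatrix}$. *)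

theory Defs
  imports
    "HOL-Analysis.Determinants"
    "HOL-Computational_Algebra.Polynomial"
    "HOL-Algebra.Coset"
    "HOL-Algebra.Generated_Groups"
begin

section \<open>Free groups and presentations\<close>

text \<open>A letter \<open>(True, x)\<close> stands for the generator \<open>x\<close>, and \<open>(False, x)\<close> for its inverse.\<close>

type_synonym 'x word = "(bool \<times> 'x) list"

definition cancel_step :: "('x word \<times> 'x word) set" where
  "cancel_step = {(u @ [(b, x), (\<not> b, x)] @ v, u @ v) | u v b x. True}"

definition free_eq :: "('x word \<times> 'x word) set" where
  "free_eq = (cancel_step \<union> cancel_step\<inverse>)\<^sup>*"

text \<open>The free group on the type \<open>'x\<close>: words modulo insertion and deletion of
  adjacent mutually inverse letters.\<close>

definition free_group :: "'x word set monoid" where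
  "free_group =
     \<lparr>carrier = UNIV // free_eq,
      mult = (\<lambda>A B. \<Union>u\<in>A. \<Union>v\<in>B. free_eq `` {u @ v}),
      one = free_eq `` {[]}\<rparr>"

definition free_gen :: "'x \<Rightarrow> 'x word set" where
  "free_gen x = free_eq `` {[(True, x)]}"

definition normal_closure :: "('a, 'm) monoid_scheme \<Rightarrow> 'a set \<Rightarrow> 'a set" where
  "normal_closure G S = \<Inter>{N. N \<lhd> G \<and> S \<subseteq> N}"

text \<open>A relation \<open>l = r\<close> between elements of the free group is the pair \<open>(l, r)\<close>; its relator
  is \<open>l r\<^sup>-\<^sup>1\<close>.  The family \<open>f\<close> of elements of \<open>G\<close> has \<open>R\<close> as a complete set of defining relations
  if the kernel of the homomorphism from the free group that extends \<open>f\<close> is the normal closure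
  of the relators.  That homomorphism is determined by \<open>f\<close> on the carrier.\<close>

definition relators :: "('x word set \<times> 'x word set) set \<Rightarrow> 'x word set set" where
  "relators R = {l \<otimes>\<^bsub>free_group\<^esub> inv\<^bsub>free_group\<^esub> r | l r. (l, r) \<in> R}"

definition defining_relations ::
  "('a, 'm) monoid_scheme \<Rightarrow> ('x \<Rightarrow> 'a) \<Rightarrow> ('x word set \<times> 'x word set) set \<Rightarrow> bool" where
  "defining_relations G f R \<longleftrightarrow>
     (\<exists>\<phi> \<in> hom free_group G.
        (\<forall>x. \<phi> (free_gen x) = f x) \<and>
        kernel free_group G \<phi> = normal_closure free_group (relators R))"

lemma equiv_free_eq: "equiv UNIV free_eq"
proof -
  have "sym (cancel_step \<union> cancel_step\<inverse>)" by (auto simp: sym_def)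
  then have "sym free_eq" unfolding free_eq_def by (rule sym_rtrancl)
  then show ?thesis
    by (simp add: equiv_def free_eq_def refl_rtrancl trans_rtrancl)
qed

lemma free_eq_append:
  assumes "(u, u') \<in> free_eq" "(v, v') \<in> free_eq"
  shows "(u @ v, u' @ v') \<in> free_eq"
proof -
  have single: "(p @ a @ q, p @ b @ q) \<in> cancel_step"
    if ab: "(a, b) \<in> cancel_step" for p q a b :: "'a word"
  proof -
    obtain u v c x where "a = u @ [(c, x), (\<not> c, x)] @ v" "b = u @ v"
      using ab unfolding cancel_step_def by blast
    then have "p @ a @ q = (p @ u) @ [(c, x), (\<not> c, x)] @ (v @ q)"
      "p @ b @ q = (p @ u) @ (v @ q)" by simp_all
    then show ?thesis unfolding cancel_step_def by blast
  qed
  have ctx: "(p @ a @ q, p @ b @ q) \<in> free_eq" if "(a, b) \<in> free_eq" for p q a b :: "'a word"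
    using that unfolding free_eq_def
  proof (induction rule: rtrancl_induct)
    case (step y z)
    then have "(p @ y @ q, p @ z @ q) \<in> cancel_step \<union> cancel_step\<inverse>"
      using single by blast
    then show ?case using step.IH by (rule rtrancl_into_rtrancl[rotated])
  qed simp
  have "(u @ v, u' @ v) \<in> free_eq" using ctx[OF assms(1), of "[]" v] by simp
  moreover have "(u' @ v, u' @ v') \<in> free_eq" using ctx[OF assms(2), of u' "[]"] by simp
  ultimately show ?thesis using equiv_free_eq by (meson equivE transD)
qed

lemma mult_free_group:
  "free_eq `` {u} \<otimes>\<^bsub>free_group\<^esub> free_eq `` {v} = free_eq `` {u @ v}"
proof -
  have eq: "free_eq `` {a @ b} = free_eq `` {u @ v}"
    if "a \<in> free_eq `` {u}" "b \<in> free_eq `` {v}" for a b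
  proof -
    have "(u @ v, a @ b) \<in> free_eq" using that by (intro free_eq_append) simp_all
    from equiv_class_eq[OF equiv_free_eq this] show ?thesis by (rule sym)
  qed
  have ne: "u \<in> free_eq `` {u}" "v \<in> free_eq `` {v}"
    using equiv_class_self[OF equiv_free_eq] by simp_all
  have "(\<Union>a\<in>free_eq `` {u}. \<Union>b\<in>free_eq `` {v}. free_eq `` {a @ b}) =
      (\<Union>a\<in>free_eq `` {u}. \<Union>b\<in>free_eq `` {v}. free_eq `` {u @ v})"
    by (intro SUP_cong refl eq)
  also have "\<dots> = free_eq `` {u @ v}" using ne by blast
  finally show ?thesis unfolding free_group_def by simp
qed

lemma group_free_group: "group (free_group :: 'x word set monoid)"
proof (rule groupI)
  let ?F = "free_group :: 'x word set monoid"
  have cls: "\<exists>u. A = free_eq `` {u}" if "A \<in> carrier ?F" for A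
    using that by (auto simp: free_group_def elim: quotientE)
  have in_carrier: "free_eq `` {u} \<in> carrier ?F" for u
    by (simp add: free_group_def quotientI)
  have one: "\<one>\<^bsub>?F\<^esub> = free_eq `` {[]}" by (simp add: free_group_def)
  show "\<one>\<^bsub>?F\<^esub> \<in> carrier ?F" using in_carrier one by simp
  show "A \<otimes>\<^bsub>?F\<^esub> B \<in> carrier ?F" if "A \<in> carrier ?F" "B \<in> carrier ?F" for A B
    using cls[OF that(1)] cls[OF that(2)] in_carrier by (auto simp: mult_free_group)
  show "A \<otimes>\<^bsub>?F\<^esub> B \<otimes>\<^bsub>?F\<^esub> C = A \<otimes>\<^bsub>?F\<^esub> (B \<otimes>\<^bsub>?F\<^esub> C)"
    if "A \<in> carrier ?F" "B \<in> carrier ?F" "C \<in> carrier ?F" for A B C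
    using cls[OF that(1)] cls[OF that(2)] cls[OF that(3)] by (auto simp: mult_free_group)
  show "\<one>\<^bsub>?F\<^esub> \<otimes>\<^bsub>?F\<^esub> A = A" if "A \<in> carrier ?F" for A
    using cls[OF that] by (auto simp: one mult_free_group)
  have inv: "(rev (map (\<lambda>(b, x). (\<not> b, x)) w) @ w, []) \<in> free_eq" for w :: "'x word"
  proof (induction w)
    case Nil
    then show ?case by (simp add: free_eq_def)
  next
    case (Cons l w)
    obtain b x where l: "l = (b, x)" by (cases l)
    let ?r = "rev (map (\<lambda>(b, x). (\<not> b, x)) w)"
    have "(?r @ [(\<not> b, x), (\<not> \<not> b, x)] @ w, ?r @ w) \<in> cancel_step"
      unfolding cancel_step_def by blast
    then have "(?r @ [(\<not> b, x), (b, x)] @ w, ?r @ w) \<in> free_eq"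
      unfolding free_eq_def by (intro r_into_rtrancl) simp
    moreover have "(?r @ w, []) \<in> free_eq" using Cons.IH .
    ultimately have "(?r @ [(\<not> b, x), (b, x)] @ w, []) \<in> free_eq"
      using equiv_free_eq by (meson equivE transD)
    then show ?case by (simp add: l)
  qed
  show "\<exists>B\<in>carrier ?F. B \<otimes>\<^bsub>?F\<^esub> A = \<one>\<^bsub>?F\<^esub>" if A: "A \<in> carrier ?F" for A
  proof -
    obtain w where w: "A = free_eq `` {w}" using cls[OF A] by blast
    have "free_eq `` {rev (map (\<lambda>(b, x). (\<not> b, x)) w)} \<otimes>\<^bsub>?F\<^esub> A = \<one>\<^bsub>?F\<^esub>"
      unfolding w mult_free_group one using equiv_class_eq[OF equiv_free_eq inv] .
    then show ?thesis using in_carrier by blast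
  qed
qed

section \<open>The group \<open>\<Gamma>\<^sup>*\<close> for \<open>F = \<rat>(\<surd>5)\<close>\<close>

definition field_F :: "real set" where
  "field_F = {a + b * sqrt 5 | a b. a \<in> \<rat> \<and> b \<in> \<rat>}"

definition O_F :: "real set" where
  "O_F = {x \<in> field_F. algebraic_int x}"

definition E_F :: "real set" where
  "E_F = {u \<in> O_F. \<exists>v\<in>O_F. u * v = 1}"

definition eps :: real where
  "eps = (1 + sqrt 5) / 2"

definition M2_OF :: "(real^2^2) monoid" where
  "M2_OF = \<lparr>carrier = {A. \<forall>i j. A $ i $ j \<in> O_F}, mult = (**), one = mat 1\<rparr>"

definition GL2_OF :: "(real^2^2) monoid" where
  "GL2_OF = units_of M2_OF"

definition Z_scalars :: "(real^2^2) set" where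
  "Z_scalars = {u *\<^sub>R mat 1 | u. u \<in> E_F}"

definition Gamma_bar :: "(real^2^2) set" where
  "Gamma_bar = {A \<in> carrier GL2_OF. \<exists>n::int. det A = eps powi n}"

definition Gamma_star :: "(real^2^2) set monoid" where
  "Gamma_star = GL2_OF\<lparr>carrier := Z_scalars <#>\<^bsub>GL2_OF\<^esub> Gamma_bar\<rparr> Mod Z_scalars"

definition image_in_PGL :: "real^2^2 \<Rightarrow> (real^2^2) set" where
  "image_in_PGL A = Z_scalars #>\<^bsub>GL2_OF\<^esub> A"

definition sigma :: "(real^2^2) set" where
  "sigma = image_in_PGL (vector [vector [0, 1], vector [-1, 0]])"

definition nu :: "(real^2^2) set" where
  "nu = image_in_PGL (vector [vector [eps, 0], vector [0, 1]])"

definition tau :: "(real^2^2) set" where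
  "tau = image_in_PGL (vector [vector [1, 1], vector [0, 1]])"

datatype generator = Sigma_gen | Nu_gen | Tau_gen

definition generator_image :: "generator \<Rightarrow> (real^2^2) set" where
  "generator_image g = (case g of Sigma_gen \<Rightarrow> sigma | Nu_gen \<Rightarrow> nu | Tau_gen \<Rightarrow> tau)"

definition relations_in ::
  "('a, 'm) monoid_scheme \<Rightarrow> 'a \<Rightarrow> 'a \<Rightarrow> 'a \<Rightarrow> ('a \<times> 'a) set" where
  "relations_in G s n t =
     {(s [^] (2::nat), \<one>),
      ((s \<otimes> t) [^] (3::nat), \<one>),
      ((s \<otimes> n) [^] (2::nat), \<one>),
      (t \<otimes> n \<otimes> t \<otimes> inv n, n \<otimes> t \<otimes> inv n \<otimes> t),
      (n [^] (2::nat) \<otimes> t \<otimes> n [^] (-2::int), t \<otimes> n \<otimes> t \<otimes> inv n)}"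
  for G (structure)

definition Gamma_star_relations :: "(generator word set \<times> generator word set) set" where
  "Gamma_star_relations =
     relations_in free_group (free_gen Sigma_gen) (free_gen Nu_gen) (free_gen Tau_gen)"

end

theory Submission
  imports Defs
begin

text \<open>Consider the graph of cusps of \<open>F\<close> in which \<open>a / c\<close> and \<open>b / d\<close> are adjacent if \<open>a d - b c\<close> is a unit.  The relations (iv'), (v')
  present the stabiliser of \<open>\<infinity>\<close>, (i') and (iii') that of the edge \<open>{\<infinity>, 0}\<close>, and (ii') says that triangles
  lift, so completeness amounts to simple connectivity of the graph with its triangles filled in.
  Order the cusps by the height \<open>|N c|\<close> and push paths down.  The neighbours of \<open>a / c\<close> are indexed by
  \<open>x \<in> \<int>[\<epsilon>]\<close> with denominators \<open>d + x c\<close>, and those below \<open>a / c\<close> are the \<open>x\<close> with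
  \<open>|N (d / c + x)| < 1\<close>.  This set is connected under steps by units: subtracting a suitable \<open>\<plusminus>\<epsilon>\<^sup>k\<close>
  moves a point along the arms of the hyperbolic region into the square where both conjugates are at
  most 1 in absolute value, and any two points of the square differ by a unit.\<close>

section \<open>The ring \<open>\<int>[\<epsilon>]\<close>\<close>

text \<open>Unit steps matter because the neighbours of a cusp with parameters \<open>x\<close> and
  \<open>x'\<close> are themselves adjacent exactly when \<open>x' - x\<close> is a unit, so such a
  step is a triangle. No complex is built. Instead, in an arbitrary group satisfying the relations,
  the predicate \<open>D\<close> links an element to the matrices over which it is reached by a
  height-increasing path. By definition \<open>D\<close> survives right multiplication by powers of
  \<open>n\<close> and by translations; the content is that it survives \<open>s\<close> also when
  the height does not increase. Then the value of every word is linked to the matrix of that word,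
  and over a scalar matrix only the identity is linked. Applying this to quotients of the free group
  gives completeness. The obstacle is an edge between cusps of equal height: it needs a third cusp
  strictly below both. This and the shrinking of the arms rest on one estimate, which uses that
  \<open>eps\<close> and its conjugate have opposite signs: a suitable unit brings the product of
  the two coordinates down to at most \<open>1 / eps\<close>.\<close>

datatype golden = Golden int int

fun val :: "golden \<Rightarrow> real" where
  "val (Golden a b) = of_int a + of_int b * eps"

text \<open>The Galois conjugate sends \<open>eps\<close> to \<open>1 - eps\<close>. Elements are
  kept as coefficient pairs so that this map, which is discontinuous on the real numbers involved,
  is given by a formula.\<close>

fun conjg :: "golden \<Rightarrow> golden" where
  "conjg (Golden a b) = Golden (a + b) (- b)"

fun gnorm :: "golden \<Rightarrow> int" where
  "gnorm (Golden a b) = a * a + a * b - b * b"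

definition height :: "golden \<Rightarrow> nat" where
  "height x = nat \<bar>gnorm x\<bar>"

instantiation golden :: comm_ring_1
begin

fun plus_golden :: "golden \<Rightarrow> golden \<Rightarrow> golden" where
  "plus_golden (Golden a b) (Golden c d) = Golden (a + c) (b + d)"

fun uminus_golden :: "golden \<Rightarrow> golden" where
  "uminus_golden (Golden a b) = Golden (- a) (- b)"

fun minus_golden :: "golden \<Rightarrow> golden \<Rightarrow> golden" where
  "minus_golden (Golden a b) (Golden c d) = Golden (a - c) (b - d)"

fun times_golden :: "golden \<Rightarrow> golden \<Rightarrow> golden" where
  "times_golden (Golden a b) (Golden c d) = Golden (a * c + b * d) (a * d + b * c + b * d)"

definition "0 = Golden 0 0"
definition "1 = Golden 1 0"

instance
proof
  fix x y z :: golden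
  show "x * y * z = x * (y * z)" "x * y = y * x" "(x + y) * z = x * z + y * z"
    "x + y + z = x + (y + z)" "x + y = y + x" "x - y = x + - y"
    by (cases x; cases y; cases z; simp add: algebra_simps)+
  show "0 + x = x" "1 * x = x" "- x + x = 0"
    by (cases x; simp add: zero_golden_def one_golden_def)+
qed (simp add: zero_golden_def one_golden_def)

end

lemma eps_bounds: "1 < eps" "eps < 2" "3/2 < eps" "eps < 5/3"
proof -
  have "2 < sqrt 5" by (rule real_less_rsqrt) simp
  moreover have "sqrt 5 < 7/3" by (rule real_less_lsqrt) (simp_all add: power2_eq_square)
  ultimately show "1 < eps" "eps < 2" "3/2 < eps" "eps < 5/3"
    by (simp_all add: eps_def)
qed

lemma eps_square: "eps * eps = eps + 1"
proof -
  have "sqrt 5 * sqrt 5 = 5" by simp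
  then show ?thesis unfolding eps_def by (simp add: field_simps)
qed

lemma inverse_eps: "inverse eps = eps - 1"
  by (rule inverse_unique) (simp add: algebra_simps eps_square)

lemma sqrt5_eps: "sqrt 5 = 2 * eps - 1"
  by (simp add: eps_def field_simps)

lemma sqrt5_irrational: "sqrt 5 \<notin> \<rat>"
proof
  assume "sqrt 5 \<in> \<rat>"
  moreover have "algebraic_int (sqrt 5)"
    by (rule algebraic_int_sqrt) (simp add: int_imp_algebraic_int)
  ultimately obtain k :: int where k: "sqrt 5 = of_int k"
    using rational_algebraic_int_is_int by (metis Ints_cases)
  have "of_int (k * k) = (5 :: real)"
    by (simp flip: k)
  then have kk: "k * k = 5" by linarith
  then have "\<bar>k\<bar> * \<bar>k\<bar> = 5" by simp
  moreover have "\<bar>k\<bar> * \<bar>k\<bar> \<le> 2 * 2" if "\<bar>k\<bar> \<le> 2" using that by (intro mult_mono) auto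
  moreover have "3 * 3 \<le> \<bar>k\<bar> * \<bar>k\<bar>" if "3 \<le> \<bar>k\<bar>" using that by (intro mult_mono) auto
  ultimately show False by linarith
qed

lemma eps_irrational: "eps \<notin> \<rat>"
proof
  assume "eps \<in> \<rat>"
  then have "2 * eps - 1 \<in> \<rat>" by (intro Rats_diff Rats_mult) auto
  then show False using sqrt5_irrational by (simp add: sqrt5_eps)
qed

lemma val_inject [simp]: "val x = val y \<longleftrightarrow> x = y"
proof
  assume eq: "val x = val y"
  obtain a b c d where xy: "x = Golden a b" "y = Golden c d" by (cases x; cases y) auto
  have *: "of_int (b - d) * eps = of_int (c - a)" using eq xy by (simp add: algebra_simps)
  have "b = d"
  proof (rule ccontr)
    assume "b \<noteq> d"
    then have "eps = of_int (c - a) / of_int (b - d)"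
      using * by (simp add: field_simps)
    also have "\<dots> \<in> \<rat>" by (intro Rats_divide Rats_of_int)
    finally show False using eps_irrational by simp
  qed
  then show "x = y" using * xy by simp
qed simp

lemma val_add [simp]: "val (x + y) = val x + val y"
  by (cases x; cases y) (simp add: algebra_simps)

lemma val_uminus [simp]: "val (- x) = - val x"
  by (cases x) simp

lemma val_diff [simp]: "val (x - y) = val x - val y"
  by (cases x; cases y) (simp add: algebra_simps)

lemma val_mult [simp]: "val (x * y) = val x * val y"
proof (cases x; cases y)
  fix a b c d assume [simp]: "x = Golden a b" "y = Golden c d"
  have "val x * val y = a * c + (a * d + b * c) * eps + b * d * (eps * eps)"
    by (simp add: algebra_simps)
  then show ?thesis by (simp add: eps_square algebra_simps)
qed

lemma val_0 [simp]: "val 0 = 0" and val_1 [simp]: "val 1 = 1"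
  by (simp_all add: zero_golden_def one_golden_def)

lemma val_eq_0_iff [simp]: "val x = 0 \<longleftrightarrow> x = 0"
  using val_inject[of x 0] by simp

lemma val_eq_1_iff [simp]: "val x = 1 \<longleftrightarrow> x = 1"
  using val_inject[of x 1] by simp

lemma conjg_conjg [simp]: "conjg (conjg x) = x"
  by (cases x) simp

lemma conjg_add [simp]: "conjg (x + y) = conjg x + conjg y"
  by (cases x; cases y) simp

lemma conjg_uminus [simp]: "conjg (- x) = - conjg x"
  by (cases x) simp

lemma conjg_diff [simp]: "conjg (x - y) = conjg x - conjg y"
  by (cases x; cases y) simp

lemma conjg_mult [simp]: "conjg (x * y) = conjg x * conjg y"
  by (cases x; cases y) (simp add: algebra_simps)

lemma conjg_0 [simp]: "conjg 0 = 0" and conjg_1 [simp]: "conjg 1 = 1"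
  by (simp_all add: zero_golden_def one_golden_def)

lemma conjg_eq_0_iff [simp]: "conjg x = 0 \<longleftrightarrow> x = 0"
  by (metis conjg_conjg conjg_0)

lemma mult_conjg: "x * conjg x = Golden (gnorm x) 0"
  by (cases x) (simp add: algebra_simps)

lemma gnorm_val: "of_int (gnorm x) = val x * val (conjg x)"
  by (simp flip: val_mult add: mult_conjg)

lemma gnorm_mult [simp]: "gnorm (x * y) = gnorm x * gnorm y"
  by (cases x; cases y) (simp add: algebra_simps)

lemma gnorm_uminus [simp]: "gnorm (- x) = gnorm x"
  by (cases x) simp

lemma gnorm_0 [simp]: "gnorm 0 = 0" and gnorm_1 [simp]: "gnorm 1 = 1"
  by (simp_all add: zero_golden_def one_golden_def)

lemma gnorm_eq_0_iff [simp]: "gnorm x = 0 \<longleftrightarrow> x = 0"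
  using gnorm_val[of x] by (metis mult_eq_0_iff of_int_eq_0_iff val_eq_0_iff conjg_eq_0_iff)

lemma height_real: "real (height x) = \<bar>val x\<bar> * \<bar>val (conjg x)\<bar>"
  unfolding height_def abs_mult[symmetric] gnorm_val[symmetric] by simp

lemma height_mult [simp]: "height (x * y) = height x * height y"
  by (simp add: height_def abs_mult nat_mult_distrib)

lemma height_uminus [simp]: "height (- x) = height x"
  by (simp add: height_def)

lemma height_0 [simp]: "height 0 = 0" and height_1 [simp]: "height 1 = 1"
  by (simp_all add: height_def)

lemma height_eq_0_iff [simp]: "height x = 0 \<longleftrightarrow> x = 0"
  by (simp add: height_def)

instance golden :: idom
proof
  fix x y :: golden
  assume "x \<noteq> 0" "y \<noteq> 0"
  then have "height (x * y) \<noteq> 0" by simp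
  then show "x * y \<noteq> 0" by (metis height_0)
qed

text \<open>The negative powers use \<open>\<epsilon>\<^sup>-\<^sup>1 = \<epsilon> - 1\<close>.\<close>

definition epow :: "int \<Rightarrow> golden" where
  "epow k = (if 0 \<le> k then Golden 0 1 ^ nat k else Golden (- 1) 1 ^ nat (- k))"

lemma val_power [simp]: "val (x ^ n) = val x ^ n"
  by (induction n) auto

lemma val_epow [simp]: "val (epow k) = eps powi k"
  by (simp add: epow_def power_int_def inverse_eps)

lemma epow_0 [simp]: "epow 0 = 1"
  by (simp add: epow_def)

lemma epow_1: "epow 1 = Golden 0 1"
  by (simp add: epow_def)

lemma epow_minus_1: "epow (- 1) = Golden (- 1) 1"
  by (simp add: epow_def)

lemma epow_add: "epow (j + k) = epow j * epow k"
  using eps_bounds by (intro val_inject[THEN iffD1]) (simp add: power_int_add)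

lemma epow_mult_minus [simp]: "epow k * epow (- k) = 1" "epow (- k) * epow k = 1"
  by (simp_all flip: epow_add)

lemma height_epow [simp]: "height (epow k) = 1"
  by (metis epow_mult_minus(1) height_1 height_mult nat_mult_eq_1_iff)

lemma abs_val_conjg_epow: "\<bar>val (conjg (epow k))\<bar> = eps powi (- k)"
proof -
  have "eps powi k * \<bar>val (conjg (epow k))\<bar> = 1"
    using height_real[of "epow k"] eps_bounds by simp
  then show ?thesis
    using eps_bounds by (simp add: power_int_minus field_simps)
qed

lemma epow_neq_0 [simp]: "epow k \<noteq> 0"
  using height_epow[of k] by (metis height_0 zero_neq_one)

text \<open>Listed explicitly, since the exponent is what the group computations need; that nothing
  else is invertible follows later from \<open>height_1_imp_unit\<close>.\<close>

definition units :: "golden set" where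
  "units = {u. \<exists>k. u = epow k \<or> u = - epow k}"

lemma units_uminus: "u \<in> units \<Longrightarrow> - u \<in> units"
  by (auto simp: units_def)

lemma epow_in_units [simp]: "epow k \<in> units"
  by (auto simp: units_def)

lemma one_in_units [simp]: "1 \<in> units"
  using epow_in_units[of 0] by simp

lemma units_mult: "u \<in> units \<Longrightarrow> v \<in> units \<Longrightarrow> u * v \<in> units"
  by (auto simp: units_def simp flip: epow_add)

lemma units_inverse:
  assumes "u \<in> units"
  obtains v where "v \<in> units" "u * v = 1" "v * u = 1"
proof -
  obtain k where "u = epow k \<or> u = - epow k" using assms by (auto simp: units_def)
  then show thesis
    using that[of "epow (- k)"] that[of "- epow (- k)"] units_uminus[OF epow_in_units] by auto
qed

lemma height_units [simp]: "u \<in> units \<Longrightarrow> height u = 1"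
  by (auto simp: units_def)

text \<open>Since \<open>eps\<close> has norm -1, its conjugate is minus its inverse, and the
  exponent can be raised or lowered one step at a time.\<close>

lemma conjg_epow: "conjg (epow k) \<in> units"
proof -
  have 1: "conjg (epow 1) = - epow (- 1)" by (simp add: epow_1 epow_minus_1)
  have m1: "conjg (epow (- 1)) = - epow 1" by (simp add: epow_1 epow_minus_1)
  show ?thesis
  proof (induction k rule: int_induct[of _ 0])
    case (step1 i)
    then show ?case using 1 by (auto simp: epow_add intro!: units_uminus units_mult)
  next
    case (step2 i)
    then show ?case using m1
      by (auto simp: epow_add diff_conv_add_uminus simp del: add_uminus_conv_diff intro!: units_uminus units_mult)
  qed simp
qed

lemma conjg_units:
  assumes "u \<in> units"
  shows "conjg u \<in> units"
proof -
  obtain k where "u = epow k \<or> u = - epow k" using assms by (auto simp: units_def)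
  then show ?thesis using conjg_epow[of k] units_uminus[OF conjg_epow[of k]] by auto
qed

section \<open>Descent by units\<close>

lemma eps_powi_cancel: "eps powi (n - 1) * eps powi (- n) = inverse eps"
  using eps_bounds by (simp add: power_int_diff power_int_minus field_simps)

text \<open>After a change of sign \<open>y1\<close> lies in \<open>[1, eps]\<close>. Both 1 and
  \<open>eps\<close> are then within \<open>eps - 1\<close> of it, and their conjugates 1 and
  \<open>1 - eps\<close> have opposite signs, so one of them lies on the same side of 0 as
  \<open>y2\<close>.\<close>

lemma unit_step_base:
  assumes "1 \<le> \<bar>y1\<bar>" "\<bar>y1\<bar> \<le> eps" "\<bar>y2\<bar> \<le> 1"
  shows "\<exists>u\<in>units. \<bar>y1 - val u\<bar> \<le> eps - 1 \<and> \<bar>y2 - val (conjg u)\<bar> \<le> 1"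
proof -
  have v: "val (epow 1) = eps" "val (conjg (epow 1)) = 1 - eps"
    by (simp_all add: epow_1)
  have *: "\<exists>u\<in>units. \<bar>y1 - val u\<bar> \<le> eps - 1 \<and> \<bar>y2 - val (conjg u)\<bar> \<le> 1"
    if "1 \<le> y1" "y1 \<le> eps" "\<bar>y2\<bar> \<le> 1" for y1 y2
  proof (cases "0 \<le> y2")
    case True
    then show ?thesis using that by (intro bexI[of _ 1]) auto
  next
    case False
    then show ?thesis using that eps_bounds by (intro bexI[of _ "epow 1"]) (auto simp: v simp del: val_epow)
  qed
  show ?thesis
  proof (cases "0 \<le> y1")
    case True
    then show ?thesis using *[of y1 y2] assms by auto
  next
    case False
    then obtain u where "u \<in> units" "\<bar>- y1 - val u\<bar> \<le> eps - 1" "\<bar>- y2 - val (conjg u)\<bar> \<le> 1"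
      using *[of "- y1" "- y2"] assms by auto
    then show ?thesis by (intro bexI[of _ "- u"]) (auto simp: units_uminus)
  qed
qed

text \<open>Dividing the two coordinates by \<open>eps powi n\<close> and its conjugate reduces to
  the case \<open>n = 0\<close>; the two bounds then multiply to \<open>1 / eps\<close>,
  independently of \<open>n\<close>.\<close>

lemma unit_step:
  assumes "eps powi n \<le> \<bar>y1\<bar>" "\<bar>y1\<bar> \<le> eps powi (n + 1)" "\<bar>y2\<bar> \<le> eps powi (- n)"
  shows "\<exists>u\<in>units. \<bar>y1 - val u\<bar> \<le> eps powi (n - 1) \<and> \<bar>y2 - val (conjg u)\<bar> \<le> eps powi (- n)"
proof -
  define E where "E = eps powi n"
  define E' where "E' = val (conjg (epow n))"
  have E: "E > 0" using eps_bounds by (simp add: E_def)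
  have E': "\<bar>E'\<bar> = eps powi (- n)" by (simp add: E'_def abs_val_conjg_epow)
  have E'0: "\<bar>E'\<bar> > 0" unfolding E' using eps_bounds by simp
  have p1: "eps powi (n + 1) = E * eps"
    using eps_bounds by (simp add: E_def power_int_add)
  have "eps powi (n - 1) = E / eps"
    using eps_bounds by (simp add: E_def power_int_diff)
  then have m1: "eps powi (n - 1) = E * (eps - 1)"
    by (simp only: divide_inverse inverse_eps)
  have "1 \<le> \<bar>y1 / E\<bar>" "\<bar>y1 / E\<bar> \<le> eps"
    using assms(1,2) E unfolding p1 by (simp_all add: E_def[symmetric] field_simps)
  moreover have "\<bar>y2 / E'\<bar> \<le> 1"
    using assms(3) E'0 unfolding E'[symmetric] by (simp add: field_simps)
  ultimately obtain u where u: "u \<in> units" "\<bar>y1 / E - val u\<bar> \<le> eps - 1"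
      "\<bar>y2 / E' - val (conjg u)\<bar> \<le> 1"
    using unit_step_base by blast
  have "y1 - val (epow n * u) = E * (y1 / E - val u)"
    using E by (simp add: E_def[symmetric] field_simps)
  then have 1: "\<bar>y1 - val (epow n * u)\<bar> \<le> E * (eps - 1)"
    using u(2) E by (simp add: abs_mult mult_left_mono)
  have "y2 - val (conjg (epow n * u)) = E' * (y2 / E' - val (conjg u))"
    using E'0 by (simp add: E'_def field_simps)
  then have 2: "\<bar>y2 - val (conjg (epow n * u))\<bar> \<le> \<bar>E'\<bar>"
    using u(3) E'0 by (simp add: abs_mult mult_left_le)
  show ?thesis
    using 1 2 units_mult[OF epow_in_units u(1)] unfolding m1 E'[symmetric] by blast
qed

lemma eps_powi_bracket:
  assumes "y > 0"
  obtains n where "eps powi n \<le> y" "y < eps powi (n + 1)"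
proof
  have 1: "1 < eps" by (rule eps_bounds)
  have powr: "eps powi k = eps powr k" for k
    using 1 by (simp add: powr_real_of_int')
  have y: "y = eps powr log eps y" using 1 assms by simp
  show "eps powi \<lfloor>log eps y\<rfloor> \<le> y"
    unfolding powr by (subst (2) y) (use 1 in \<open>intro powr_mono; linarith\<close>)
  show "y < eps powi (\<lfloor>log eps y\<rfloor> + 1)"
    unfolding powr by (subst y) (use 1 in \<open>intro powr_less_mono; linarith\<close>)
qed

lemma height_scale:
  assumes "c \<noteq> 0"
  shows "real (height (d + x * c)) = real (height c) *
    (\<bar>val d / val c + val x\<bar> * \<bar>val (conjg d) / val (conjg c) + val (conjg x)\<bar>)"
proof -
  have "val (d + x * c) = val c * (val d / val c + val x)"
    "val (conjg (d + x * c)) = val (conjg c) * (val (conjg d) / val (conjg c) + val (conjg x))"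
    using assms by (simp_all add: field_simps)
  then show ?thesis by (simp add: height_real abs_mult)
qed

lemma height_less_iff:
  assumes "c \<noteq> 0"
  shows "height (d + x * c) < height c \<longleftrightarrow>
    \<bar>val d / val c + val x\<bar> * \<bar>val (conjg d) / val (conjg c) + val (conjg x)\<bar> < 1"
proof -
  have pos: "0 < real (height c)" using assms by (simp add: zero_less_iff_neq_zero)
  have "height (d + x * c) < height c \<longleftrightarrow> real (height (d + x * c)) < real (height c)"
    by simp
  then show ?thesis unfolding height_scale[OF assms] using pos by simp
qed

text \<open>Supplies the cusp below both ends of an edge of equal heights. The quotient of
  \<open>d\<close> by \<open>c\<close> has norm at most 1 in absolute value, so a power of
  \<open>eps\<close> bracketing its first coordinate also bounds the second one, and
  \<open>unit_step\<close> applies.\<close>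

lemma unit_descent:
  assumes "c \<noteq> 0" "d \<noteq> 0" "height d \<le> height c"
  shows "\<exists>u\<in>units. height (d + u * c) < height c"
proof -
  define y1 where "y1 = val d / val c"
  define y2 where "y2 = val (conjg d) / val (conjg c)"
  have pos: "0 < real (height c)" using assms by (simp add: zero_less_iff_neq_zero)
  have y1: "0 < \<bar>y1\<bar>" using assms by (simp add: y1_def)
  have "real (height d) = real (height c) * (\<bar>y1\<bar> * \<bar>y2\<bar>)"
    using height_scale[OF assms(1), of d 0] by (simp add: y1_def y2_def)
  then have "real (height c) * (\<bar>y1\<bar> * \<bar>y2\<bar>) \<le> real (height c) * 1"
    using assms(3) by simp
  then have le1: "\<bar>y1\<bar> * \<bar>y2\<bar> \<le> 1" using pos by (simp only: mult_le_cancel_left_pos)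
  obtain n where n: "eps powi n \<le> \<bar>y1\<bar>" "\<bar>y1\<bar> < eps powi (n + 1)"
    using eps_powi_bracket[OF y1] .
  have E: "eps powi n > 0" using eps_bounds by simp
  have "eps powi n * \<bar>y2\<bar> \<le> 1" using le1 mult_right_mono[OF n(1), of "\<bar>y2\<bar>"] by simp
  then have "\<bar>y2\<bar> \<le> eps powi (- n)" using E by (simp add: power_int_minus field_simps)
  then obtain u where u: "u \<in> units" "\<bar>y1 - val u\<bar> \<le> eps powi (n - 1)"
      "\<bar>y2 - val (conjg u)\<bar> \<le> eps powi (- n)"
    using unit_step n by (metis less_imp_le)
  have "\<bar>y1 - val u\<bar> * \<bar>y2 - val (conjg u)\<bar> \<le> eps powi (n - 1) * eps powi (- n)"
    using u eps_bounds by (intro mult_mono) auto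
  also have "\<dots> = inverse eps" by (rule eps_powi_cancel)
  also have "\<dots> < 1" using eps_bounds by (simp add: inverse_eps)
  finally have "height (d + (- u) * c) < height c"
    using height_less_iff[OF assms(1), of d "- u"] by (simp add: y1_def y2_def)
  then show ?thesis using u(1) units_uminus by blast
qed

section \<open>Connectedness of the hyperbolic region under unit steps\<close>

definition hyp_region :: "real \<Rightarrow> real \<Rightarrow> golden set" where
  "hyp_region y1 y2 = {x. \<bar>y1 + val x\<bar> * \<bar>y2 + val (conjg x)\<bar> < 1}"

definition unit_steps :: "golden set \<Rightarrow> (golden \<times> golden) set" where
  "unit_steps S = {(x, x'). x \<in> S \<and> x' \<in> S \<and> x' - x \<in> units}"

lemma sym_unit_steps: "sym (unit_steps S)"
proof (rule symI)
  fix x x' assume "(x, x') \<in> unit_steps S"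
  then show "(x', x) \<in> unit_steps S"
    using units_uminus[of "x' - x"] by (auto simp: unit_steps_def)
qed

text \<open>Conjugation exchanges the two arms, so only one of them has to be treated; this is why
  \<open>y1\<close> and \<open>y2\<close> are independent real parameters.\<close>

lemma hyp_region_conjg: "conjg x \<in> hyp_region y1 y2 \<longleftrightarrow> x \<in> hyp_region y2 y1"
  by (simp add: hyp_region_def mult.commute)

lemma unit_steps_conjg:
  assumes "(x, x') \<in> (unit_steps (hyp_region y2 y1))\<^sup>*"
  shows "(conjg x, conjg x') \<in> (unit_steps (hyp_region y1 y2))\<^sup>*"
  using assms
proof (induction rule: rtrancl_induct)
  case (step y z)
  then have "(conjg y, conjg z) \<in> unit_steps (hyp_region y1 y2)"
    using conjg_units[of "z - y"] by (simp add: unit_steps_def hyp_region_conjg)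
  with step.IH show ?case by (rule rtrancl_into_rtrancl)
qed simp

definition unit_box :: "real \<Rightarrow> real \<Rightarrow> golden set" where
  "unit_box y1 y2 = {x. \<bar>y1 + val x\<bar> \<le> 1 \<and> \<bar>y2 + val (conjg x)\<bar> \<le> 1}"

text \<open>Each subtraction of a unit lowers the bound on the long coordinate by a factor
  \<open>eps\<close> and keeps the short one at most 1.\<close>

lemma arm_to_box:
  assumes "x \<in> hyp_region y1 y2" "\<bar>y1 + val x\<bar> \<le> eps ^ n" "\<bar>y2 + val (conjg x)\<bar> \<le> 1"
  shows "\<exists>z \<in> unit_box y1 y2. (x, z) \<in> (unit_steps (hyp_region y1 y2))\<^sup>*"
  using assms
proof (induction n arbitrary: x)
  case 0
  then show ?case by (auto simp: unit_box_def)
next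
  case (Suc n)
  show ?case
  proof (cases "\<bar>y1 + val x\<bar> \<le> eps ^ n")
    case True
    then show ?thesis using Suc by blast
  next
    case False
    let ?z1 = "y1 + val x" and ?z2 = "y2 + val (conjg x)"
    have E: "eps powi int n > 0" using eps_bounds by simp
    have le: "eps powi int n \<le> \<bar>?z1\<bar>" "\<bar>?z1\<bar> \<le> eps powi (int n + 1)"
      using False Suc.prems eps_bounds by (simp_all add: power_int_add mult.commute)
    have lt1: "\<bar>?z1\<bar> * \<bar>?z2\<bar> < 1" using Suc.prems(1) by (simp add: hyp_region_def)
    then have "eps powi int n * \<bar>?z2\<bar> \<le> 1" using mult_right_mono[OF le(1), of "\<bar>?z2\<bar>"] by simp
    then have "\<bar>?z2\<bar> \<le> eps powi (- int n)" using E by (simp add: power_int_minus field_simps)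
    then obtain u where u: "u \<in> units" "\<bar>?z1 - val u\<bar> \<le> eps powi (int n - 1)"
        "\<bar>?z2 - val (conjg u)\<bar> \<le> eps powi (- int n)"
      using unit_step le by blast
    \<comment> \<open>The product of the two bounds is \<open>1 / eps < 1\<close>, so the new point
      does not leave the region.\<close>
    have "\<bar>?z1 - val u\<bar> * \<bar>?z2 - val (conjg u)\<bar> \<le> eps powi (int n - 1) * eps powi (- int n)"
      using u eps_bounds by (intro mult_mono) auto
    also have "\<dots> = inverse eps" by (rule eps_powi_cancel)
    also have "\<dots> < 1" using eps_bounds by (simp add: inverse_eps)
    finally have S: "x - u \<in> hyp_region y1 y2"
      by (simp add: hyp_region_def algebra_simps)
    have "eps powi (int n - 1) \<le> eps powi int n"
      using eps_bounds by (intro power_int_increasing) auto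
    then have 1: "\<bar>y1 + val (x - u)\<bar> \<le> eps ^ n" using u(2) by (simp add: algebra_simps)
    have "eps powi (- int n) \<le> eps powi 0"
      using eps_bounds by (intro power_int_increasing) auto
    then have 2: "\<bar>y2 + val (conjg (x - u))\<bar> \<le> 1" using u(3) by (simp add: algebra_simps)
    obtain z where "z \<in> unit_box y1 y2" "(x - u, z) \<in> (unit_steps (hyp_region y1 y2))\<^sup>*"
      using Suc.IH[OF S 1 2] by blast
    moreover have "(x, x - u) \<in> unit_steps (hyp_region y1 y2)"
      using S Suc.prems(1) u(1) by (simp add: unit_steps_def units_uminus)
    ultimately show ?thesis by (meson converse_rtrancl_into_rtrancl)
  qed
qed

lemma region_to_box:
  assumes "x \<in> hyp_region y1 y2"
  shows "\<exists>z \<in> unit_box y1 y2. (x, z) \<in> (unit_steps (hyp_region y1 y2))\<^sup>*"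
proof -
  have large: "\<exists>n. r \<le> eps ^ n" for r
    using real_arch_pow[of eps r] eps_bounds by (auto intro: less_imp_le)
  consider "\<bar>y2 + val (conjg x)\<bar> \<le> 1" | "\<bar>y1 + val x\<bar> \<le> 1"
  proof -
    have "\<not> (1 < \<bar>y1 + val x\<bar> \<and> 1 < \<bar>y2 + val (conjg x)\<bar>)"
      using assms by (auto simp: hyp_region_def dest: less_1_mult)
    then show thesis using that by linarith
  qed
  then show ?thesis
  proof cases
    case 1
    then show ?thesis using large[of "\<bar>y1 + val x\<bar>"] arm_to_box assms by blast
  next
    case 2
    obtain n where n: "\<bar>y2 + val (conjg x)\<bar> \<le> eps ^ n" using large by blast
    obtain z where z: "z \<in> unit_box y2 y1" "(conjg x, z) \<in> (unit_steps (hyp_region y2 y1))\<^sup>*"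
      using arm_to_box[of "conjg x" y2 y1 n] 2 n assms by (auto simp: hyp_region_conjg)
    have "(x, conjg z) \<in> (unit_steps (hyp_region y1 y2))\<^sup>*"
      using unit_steps_conjg[OF z(2)] by simp
    moreover have "conjg z \<in> unit_box y1 y2" using z(1) by (simp add: unit_box_def)
    ultimately show ?thesis by blast
  qed
qed

text \<open>Two points of the box differ by an element both of whose conjugates are at most 2 in
  absolute value; apart from units these are only \<open>0\<close> and \<open>\<plusminus>2\<close>, and \<open>\<plusminus>2\<close> would need corners.\<close>

lemma box_adjacent:
  assumes "x \<in> unit_box y1 y2" "x' \<in> unit_box y1 y2" "x \<in> hyp_region y1 y2"
  shows "x' = x \<or> x' - x \<in> units"
proof -
  obtain a b where ab: "x' - x = Golden a b" by (cases "x' - x")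
  have v: "val x' - val x = a + b * eps"
    using arg_cong[OF ab, of val] by simp
  have "conjg x' - conjg x = Golden (a + b) (- b)"
    using arg_cong[OF ab, of conjg] by simp
  from arg_cong[OF this, of val] have v': "val (conjg x') - val (conjg x) = a + b - b * eps"
    by simp
  have l: "\<bar>a + b * eps\<bar> \<le> 2" "\<bar>a + b - b * eps\<bar> \<le> 2"
    unfolding v[symmetric] v'[symmetric] using assms by (auto simp: unit_box_def)
  \<comment> \<open>The sum of the two conjugates is \<open>2 * a + b\<close>, their difference is
    \<open>b\<close> times \<open>sqrt 5 = 2 * eps - 1\<close>; bounding both leaves finitely many
    pairs.\<close>
  have "\<bar>2 * a + b\<bar> \<le> (4::real)" using l by linarith
  then have s: "\<bar>2 * a + b\<bar> \<le> 4" by linarith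
  have "\<bar>b\<bar> * (2 * eps - 1) = \<bar>b * (2 * eps - 1)\<bar>" using eps_bounds by (simp add: abs_mult)
  also have "\<dots> \<le> 4" using l by (simp add: algebra_simps)
  finally have "\<bar>b\<bar> * (2 * eps - 1) \<le> 4" .
  moreover have "real_of_int \<bar>b\<bar> * 2 \<le> \<bar>b\<bar> * (2 * eps - 1)" using eps_bounds by (intro mult_left_mono) auto
  ultimately have b2: "\<bar>b\<bar> \<le> (2::real)" by linarith
  have "\<bar>b\<bar> \<noteq> 2"
  proof
    assume "\<bar>b\<bar> = 2"
    then have "real_of_int \<bar>b\<bar> = 2" by linarith
    with \<open>\<bar>b\<bar> * (2 * eps - 1) \<le> 4\<close> have "2 * (2 * eps - 1) \<le> 4" by (simp only:)
    then show False using eps_bounds(3) by (simp add: field_simps)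
  qed
  then have "\<bar>b\<bar> \<le> 1" using b2 by linarith
  then consider "b = 0" | "b = 1" | "b = - 1" by linarith
  then show ?thesis
  proof cases
    case 1
    then have "\<bar>a\<bar> \<le> 2" using s by linarith
    moreover have "\<bar>a\<bar> \<noteq> 2"
    proof
      assume "\<bar>a\<bar> = 2"
      then have "\<bar>val x' - val x\<bar> = 2" "\<bar>val (conjg x') - val (conjg x)\<bar> = 2"
        unfolding v v' using 1 by auto
      then have "\<bar>y1 + val x\<bar> = 1" "\<bar>y2 + val (conjg x)\<bar> = 1"
        using assms by (auto simp: unit_box_def)
      then show False using assms(3) by (simp add: hyp_region_def)
    qed
    ultimately consider "a = 0" | "a = 1" | "a = - 1" by linarith
    then show ?thesis
    proof cases
      case 1
      then have "x' - x = 0" using ab \<open>b = 0\<close> by (simp add: zero_golden_def)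
      then show ?thesis by simp
    next
      case 2
      then have "x' - x = 1" using ab \<open>b = 0\<close> by (simp add: one_golden_def)
      then show ?thesis by simp
    next
      case 3
      then have "x' - x = - 1" using ab \<open>b = 0\<close> by (simp add: one_golden_def)
      then show ?thesis by (simp add: units_uminus)
    qed
  next
    case 2
    \<comment> \<open>The two remaining differences are \<open>eps\<close> and
      \<open>eps - 1\<close>, the latter being the inverse of \<open>eps\<close>.\<close>
    then have "a > -2" "a < 1" using l eps_bounds by auto
    then have "a = 0 \<or> a = - 1" by linarith
    then have "x' - x = epow 1 \<or> x' - x = epow (- 1)"
      using ab 2 by (auto simp: epow_1 epow_minus_1)
    then show ?thesis using epow_in_units by metis
  next
    case 3
    then have "a > -1" "a < 2" using l eps_bounds by auto
    then have "a = 0 \<or> a = 1" by linarith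
    then have "x' - x = - epow 1 \<or> x' - x = - epow (- 1)"
      using ab 3 by (auto simp: epow_1 epow_minus_1)
    then show ?thesis using epow_in_units units_uminus by metis
  qed
qed

lemma hyp_region_connected:
  assumes "x \<in> hyp_region y1 y2" "x' \<in> hyp_region y1 y2"
  shows "(x, x') \<in> (unit_steps (hyp_region y1 y2))\<^sup>*"
proof -
  let ?R = "unit_steps (hyp_region y1 y2)"
  have inS: "z \<in> hyp_region y1 y2" if "(x, z) \<in> ?R\<^sup>*" "x \<in> hyp_region y1 y2" for x z
    using that by (induction rule: rtrancl_induct) (auto simp: unit_steps_def)
  obtain z z' where z: "z \<in> unit_box y1 y2" "(x, z) \<in> ?R\<^sup>*" "z' \<in> unit_box y1 y2" "(x', z') \<in> ?R\<^sup>*"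
    using region_to_box assms by meson
  have S: "z \<in> hyp_region y1 y2" "z' \<in> hyp_region y1 y2" using inS z assms by blast+
  then have "z' = z \<or> (z, z') \<in> ?R"
    using box_adjacent[OF z(1) z(3)] by (auto simp: unit_steps_def)
  then have "(x, z') \<in> ?R\<^sup>*" using z(2) by auto
  moreover have "(z', x') \<in> ?R\<^sup>*"
    using z(4) sym_rtrancl[OF sym_unit_steps] by (meson symD)
  ultimately show ?thesis by (rule rtrancl_trans)
qed

text \<open>Connectedness in the form of an induction rule: a property of one lower neighbour of a
  cusp spreads to all of them, through unit steps whose two ends are both lower.\<close>

lemma descending_induct [consumes 3, case_names start step]:
  assumes "c \<noteq> 0" "height (d + x0 * c) < height c" "height (d + x * c) < height c"
    and start: "P x0"
    and step: "\<And>x u. P x \<Longrightarrow> u \<in> units \<Longrightarrow> height (d + x * c) < height c \<Longrightarrow>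
      height (d + (x + u) * c) < height c \<Longrightarrow> P (x + u)"
  shows "P x"
proof -
  define y1 where "y1 = val d / val c"
  define y2 where "y2 = val (conjg d) / val (conjg c)"
  have S: "z \<in> hyp_region y1 y2 \<longleftrightarrow> height (d + z * c) < height c" for z
    using height_less_iff[OF assms(1), of d z] by (simp add: hyp_region_def y1_def y2_def)
  have "(x0, x) \<in> (unit_steps (hyp_region y1 y2))\<^sup>*"
    using assms(2,3) hyp_region_connected S by blast
  then show ?thesis
  proof (induction rule: rtrancl_induct)
    case (step y z)
    then show ?case using assms(5)[of y "z - y"] by (simp add: unit_steps_def S)
  qed (rule start)
qed

section \<open>The integers and units of \<open>F\<close>\<close>

text \<open>In coordinates with respect to 1 and \<open>eps\<close> the norm is
  \<open>(P + Q / 2)\<^sup>2 - 5 / 4 * Q\<^sup>2\<close>. Rounding makes both \<open>Q\<close> and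
  \<open>P + Q / 2\<close> at most 1/2 in absolute value, so the norm lies between -5/16 and
  1/4.\<close>

lemma golden_euclid:
  assumes "c \<noteq> 0"
  shows "\<exists>x. height (d + x * c) < height c"
proof -
  define y1 where "y1 = val d / val c"
  define y2 where "y2 = val (conjg d) / val (conjg c)"
  define q where "q = (y1 - y2) / (2 * eps - 1)"
  define p where "p = y1 - q * eps"
  define n where "n = - round q"
  define Q where "Q = q + n"
  \<comment> \<open>What is rounded is the completed square, after \<open>Q\<close> has been fixed,
    and not \<open>p\<close> itself.\<close>
  define m where "m = - round (p + Q / 2)"
  define P where "P = p + m"
  have s: "2 * eps - 1 \<noteq> 0" using eps_bounds by linarith
  have y1: "y1 = p + q * eps" by (simp add: p_def)
  have "y1 - y2 = q * (2 * eps - 1)" using s by (simp add: q_def)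
  then have y2: "y2 = p + q - q * eps" using y1 by (simp add: algebra_simps)
  let ?x = "Golden m n"
  have "(y1 + val ?x) * (y2 + val (conjg ?x)) = (P + Q * eps) * (P + Q - Q * eps)"
    by (simp add: y1 y2 P_def Q_def algebra_simps)
  also have "\<dots> = P * P + P * Q + Q * Q * eps - Q * Q * (eps * eps)"
    by (simp add: algebra_simps)
  also have "\<dots> = (P + Q / 2)\<^sup>2 - 5 / 4 * Q\<^sup>2"
    unfolding eps_square by (simp add: power2_eq_square field_simps)
  finally have eq: "(y1 + val ?x) * (y2 + val (conjg ?x)) = (P + Q / 2)\<^sup>2 - 5 / 4 * Q\<^sup>2" .
  have "\<bar>Q\<bar> \<le> 1 / 2" using of_int_round_abs_le[of q] by (simp add: Q_def n_def abs_minus_commute)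
  then have "Q\<^sup>2 \<le> (1 / 2)\<^sup>2" by (metis abs_ge_zero power2_abs power_mono)
  moreover have "\<bar>P + Q / 2\<bar> \<le> 1 / 2"
    using of_int_round_abs_le[of "p + Q / 2"] by (simp add: P_def m_def abs_minus_commute algebra_simps)
  then have "(P + Q / 2)\<^sup>2 \<le> (1 / 2)\<^sup>2" by (metis abs_ge_zero power2_abs power_mono)
  moreover have "0 \<le> Q\<^sup>2" "0 \<le> (P + Q / 2)\<^sup>2" by simp_all
  moreover have "(1 / 2 :: real)\<^sup>2 = 1 / 4" by (simp add: power2_eq_square)
  ultimately have "\<bar>(y1 + val ?x) * (y2 + val (conjg ?x))\<bar> < 1"
    unfolding eq by linarith
  then show ?thesis
    using height_less_iff[OF assms, of d ?x] by (auto simp: abs_mult y1_def y2_def)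
qed

text \<open>A power of \<open>eps\<close> moves the element into the fundamental interval where its
  absolute value is in \<open>[1, eps)\<close>. There the conjugate is squeezed into
  \<open>(1 / eps, 1]\<close> in absolute value, and integrality leaves only 1 and -1.\<close>

lemma height_1_imp_unit:
  assumes "height g = 1"
  shows "g \<in> units"
proof -
  have "g \<noteq> 0" using assms by auto
  then have "0 < \<bar>val g\<bar>" by simp
  then obtain n where n: "eps powi n \<le> \<bar>val g\<bar>" "\<bar>val g\<bar> < eps powi (n + 1)"
    by (rule eps_powi_bracket)
  define h where "h = epow (- n) * g"
  have gh: "g = epow n * h" by (simp add: h_def flip: mult.assoc)
  have hh: "height h = 1" using assms by (simp add: h_def)
  have E: "eps powi n > 0" using eps_bounds by simp
  have vg: "\<bar>val g\<bar> = eps powi n * \<bar>val h\<bar>" using E by (simp add: gh abs_mult)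
  have "eps powi n * 1 \<le> eps powi n * \<bar>val h\<bar>" "eps powi n * \<bar>val h\<bar> < eps powi n * eps"
    using n eps_bounds unfolding vg by (simp_all add: power_int_add)
  then have h1: "1 \<le> \<bar>val h\<bar>" "\<bar>val h\<bar> < eps"
    using E by (simp_all only: mult_le_cancel_left_pos mult_less_cancel_left_pos)
  have h2: "\<bar>val h\<bar> * \<bar>val (conjg h)\<bar> = 1" using hh height_real[of h] by simp
  have h3: "\<bar>val (conjg h)\<bar> \<le> 1"
    using h2 h1 mult_right_mono[OF h1(1), of "\<bar>val (conjg h)\<bar>"] by simp
  have h4: "eps - 1 < \<bar>val (conjg h)\<bar>"
  proof (rule ccontr)
    assume "\<not> ?thesis"
    then have "\<bar>val h\<bar> * \<bar>val (conjg h)\<bar> < eps * (eps - 1)"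
      using h1 eps_bounds by (intro mult_less_le_imp_less) (use h2 in auto)
    then show False unfolding h2 by (simp add: algebra_simps eps_square)
  qed
  have unit: "h \<in> units" if h1: "1 \<le> val h" "val h < eps" and h3: "\<bar>val (conjg h)\<bar> \<le> 1"
    and h4: "eps - 1 < \<bar>val (conjg h)\<bar>" for h
  proof -
    obtain a b where h: "h = Golden a b" by (cases h)
    have tr: "val h + val (conjg h) = 2 * a + b" and df: "val h - val (conjg h) = b * (2 * eps - 1)"
      by (simp_all add: h algebra_simps)
    have s: "2 * eps - 1 > 2" using eps_bounds by linarith
    show ?thesis
    proof (cases "0 \<le> val (conjg h)")
      case True
      \<comment> \<open>The difference of the conjugates is below
        \<open>eps - (eps - 1) = 1\<close>, but it is an integer multiple of
        \<open>sqrt 5\<close>.\<close>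
      have lt: "b * (2 * eps - 1) < 1" "b * (2 * eps - 1) \<ge> 0"
        unfolding df[symmetric] using True h1 h3 h4 by linarith+
      have "b = 0"
      proof (rule ccontr)
        assume "b \<noteq> 0"
        moreover have "0 \<le> b" using lt(2) s by (simp add: zero_le_mult_iff)
        ultimately have "1 \<le> real_of_int b" by linarith
        then have "1 * (2 * eps - 1) \<le> b * (2 * eps - 1)" using s by (intro mult_right_mono) auto
        then have "2 * eps - 1 < 1" using lt(1) by (simp only: mult_1_left order.strict_trans1)
        then show False using s by simp
      qed
      then have "val h = val (conjg h)" using df by simp
      then have "val h = 1" using h1 h3 by linarith
      then show ?thesis by simp
    next
      case False
      \<comment> \<open>For a negative conjugate the trace is an integer in \<open>[0, 1)\<close>,
        hence 0. This case is in fact contradictory; deducing \<open>h = 1\<close> suffices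
        here.\<close>
      have "0 \<le> real_of_int (2 * a + b)" "real_of_int (2 * a + b) < 1"
        using tr False h1 h3 h4 by (simp_all)
      then have "2 * a + b = 0" by linarith
      then have eq: "val (conjg h) = - val h" using tr by (metis add_eq_0_iff of_int_0)
      then have "val h = 1" using h1 h3 by linarith
      then have "h = 1" by simp
      then show ?thesis by simp
    qed
  qed
  have "h \<in> units"
  proof (cases "0 \<le> val h")
    case True
    then show ?thesis using unit[of h] h1 h3 h4 by simp
  next
    case False
    then have "- h \<in> units" using unit[of "- h"] h1 h3 h4 by simp
    then show ?thesis using units_uminus by force
  qed
  then show ?thesis unfolding gh by (intro units_mult) simp
qed

section \<open>Integral closedness of the ring\<close>

lemma int_dvd_of_power_dvd:
  fixes a b K :: int
  assumes "K \<noteq> 0" and dvd: "\<And>n. a ^ n dvd K * b ^ n"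
  shows "a dvd b"
proof (cases "a = 0 \<and> b = 0")
  case False
  define g where "g = gcd a b"
  have g: "g \<noteq> 0" using False by (simp add: g_def)
  obtain a' b' where ab: "a = g * a'" "b = g * b'" "coprime a' b'"
    using gcd_coprime_exists[of a b] g unfolding g_def by (metis mult.commute)
  have K: "a' ^ n dvd K" for n
  proof -
    have "g ^ n * a' ^ n dvd g ^ n * (K * b' ^ n)"
      using dvd[of n] by (simp add: ab power_mult_distrib algebra_simps)
    then have "a' ^ n dvd K * b' ^ n" using g by (simp add: dvd_mult_cancel_left)
    moreover have "coprime (a' ^ n) (b' ^ n)" using ab(3) by simp
    ultimately show ?thesis by (simp add: coprime_dvd_mult_left_iff)
  qed
  \<comment> \<open>Otherwise the powers of \<open>a'\<close> would be unbounded, yet all of them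
    divide the fixed nonzero \<open>K\<close>.\<close>
  have "\<bar>a'\<bar> \<le> 1"
  proof (rule ccontr)
    assume "\<not> ?thesis"
    then have "2 ^ n \<le> \<bar>a' ^ n\<bar>" for n
      unfolding power_abs by (intro power_mono) auto
    moreover have "\<bar>a' ^ n\<bar> \<le> \<bar>K\<bar>" for n
      using K[of n] assms(1) by (simp add: dvd_imp_le_int)
    moreover have "int n < 2 ^ n" for n by (metis of_nat_less_two_power)
    ultimately have "int n < \<bar>K\<bar>" for n by (meson less_le_trans)
    from this[of "nat \<bar>K\<bar>"] show False by simp
  qed
  moreover have "a' \<noteq> 0" using K[of 1] assms(1) by auto
  ultimately have "a' = 1 \<or> a' = - 1" by linarith
  then show ?thesis by (auto simp: ab)
qed simp

lemma range_val_sum: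
  assumes "\<And>i. i \<in> A \<Longrightarrow> f i \<in> range val"
  shows "sum f A \<in> range val"
proof -
  have "0 \<in> range val" by (rule range_eqI[of _ _ 0]) simp
  moreover have "x + y \<in> range val" if "x \<in> range val" "y \<in> range val" for x y
    using that by (auto simp flip: val_add)
  ultimately show ?thesis
    using assms by (induction A rule: infinite_finite_induct) auto
qed

lemma range_val_mult: "x \<in> range val \<Longrightarrow> y \<in> range val \<Longrightarrow> x * y \<in> range val"
  by (auto simp flip: val_mult)

lemma val_Golden_0: "val (Golden a 0) = of_int a"
  by simp

lemma Ints_range_val: "x \<in> \<int> \<Longrightarrow> x \<in> range val"
  by (metis Ints_cases rangeI val_Golden_0)

text \<open>The monic equation expresses every power of \<open>x\<close> through those below its
  degree \<open>d\<close>, with integer coefficients, so \<open>C ^ d\<close> clears the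
  denominators of all powers at once. The polynomial need not be minimal.\<close>

lemma algebraic_int_bounded_denominator:
  assumes "algebraic_int x" "x = val g / of_int C" "C > 0"
  obtains D :: int where "D > 0" "\<And>n. of_int D * x ^ n \<in> range val"
proof -
  obtain p :: "real poly" where p: "lead_coeff p = 1" "\<And>i. coeff p i \<in> \<int>" "poly p x = 0"
    using assms(1) by (auto simp: algebraic_int.simps)
  define d where "d = degree p"
  define D where "D = C ^ d"
  have xd: "x ^ d = - (\<Sum>i<d. coeff p i * x ^ i)"
  proof -
    have "0 = (\<Sum>i\<le>d. coeff p i * x ^ i)" using p(3) by (simp add: poly_altdef d_def)
    also have "\<dots> = (\<Sum>i<d. coeff p i * x ^ i) + x ^ d"
      using p(1) by (simp add: d_def flip: lessThan_Suc_atMost)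
    finally show ?thesis by simp
  qed
  have "of_int D * x ^ n \<in> range val" for n
  proof (induction n rule: less_induct)
    case (less n)
    show ?case
    proof (cases "n < d")
      case True
      have "of_int D * x ^ n = of_int (C ^ (d - n)) * (of_int (C ^ n) * x ^ n)"
        using True by (simp add: D_def flip: power_add mult.assoc)
      also have "of_int (C ^ n) * x ^ n = val (g ^ n)"
        using assms(2,3) by (simp add: power_divide)
      also have "of_int (C ^ (d - n)) * val (g ^ n) = val (Golden (C ^ (d - n)) 0 * g ^ n)"
        by simp
      finally show ?thesis by (metis rangeI)
    next
      case False
      then have "x ^ n = x ^ (n - d) * x ^ d" by (simp flip: power_add)
      then have "of_int D * x ^ n = (\<Sum>i<d. (- coeff p i) * (of_int D * x ^ (n - d + i)))"
        by (simp add: xd sum_distrib_left power_add algebra_simps sum_negf)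
      also have "\<dots> \<in> range val"
      proof (rule range_val_sum)
        fix i assume "i \<in> {..<d}"
        then have "n - d + i < n" using False by simp
        moreover have "- coeff p i \<in> \<int>" using p(2) by simp
        ultimately show "(- coeff p i) * (of_int D * x ^ (n - d + i)) \<in> range val"
          by (rule range_val_mult[OF Ints_range_val less.IH, rotated])
      qed
      finally show ?thesis .
    qed
  qed
  moreover have "D > 0" using assms(3) by (simp add: D_def)
  ultimately show thesis using that by blast
qed

lemma gnorm_power [simp]: "gnorm (x ^ n) = gnorm x ^ n"
  by (induction n) auto

text \<open>Taking norms turns the common denominator of the powers into divisibility of
  \<open>D * D * gnorm g ^ n\<close> by \<open>C\<^sup>2 ^ n\<close> for every \<open>n\<close>, and
  the fixed factor cannot compensate growing powers.\<close>

lemma square_dvd_gnorm: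
  assumes "C > 0" "D > 0" "\<And>n. of_int D * (val g / of_int C) ^ n \<in> range val"
  shows "C\<^sup>2 dvd gnorm g"
proof (rule int_dvd_of_power_dvd)
  show "D * D \<noteq> 0" using assms(2) by simp
  fix n
  obtain h where "of_int D * (val g / of_int C) ^ n = val h"
    using assms(3)[of n] by auto
  then have "of_int D * val g ^ n = of_int (C ^ n) * val h"
    using assms(1) by (simp add: field_simps)
  then have "val (Golden D 0 * g ^ n) = val (Golden (C ^ n) 0 * h)" by simp
  then have "Golden D 0 * g ^ n = Golden (C ^ n) 0 * h" by (simp only: val_inject)
  from arg_cong[OF this, of gnorm]
  have "(D * D) * gnorm g ^ n = (C ^ n * C ^ n) * gnorm h" by simp
  moreover have "C ^ n * C ^ n = C\<^sup>2 ^ n" by (simp add: power2_eq_square power_mult_distrib)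
  ultimately show "C\<^sup>2 ^ n dvd D * D * gnorm g ^ n" by simp
qed

text \<open>The norm criterion applied to \<open>x\<close> and to \<open>x + 1\<close> makes both
  norms integral, and their difference gives the trace. Integral trace and norm then force the
  coefficients to be divisible by \<open>C\<close>, since 5 is squarefree and congruent to 1 modulo
  4.\<close>

lemma golden_integrally_closed:
  assumes "algebraic_int (val g / of_int C)" "C > 0"
  shows "val g / of_int C \<in> range val"
proof -
  define x where "x = val g / of_int C"
  obtain D where D: "D > 0" "\<And>n. of_int D * x ^ n \<in> range val"
    using algebraic_int_bounded_denominator[OF assms(1) refl assms(2)] unfolding x_def by blast
  obtain a b where g: "g = Golden a b" by (cases g)
  have 1: "C\<^sup>2 dvd gnorm g" using square_dvd_gnorm[OF assms(2) D(1)] D(2) by (simp add: x_def)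
  have x1: "val (g + Golden C 0) / of_int C = x + 1"
    using assms(2) by (simp add: x_def add_divide_distrib)
  have 2: "C\<^sup>2 dvd gnorm (g + Golden C 0)"
  proof (rule square_dvd_gnorm[OF assms(2) D(1)])
    fix n
    have "of_int D * (x + 1) ^ n = (\<Sum>k\<le>n. of_nat (n choose k) * (of_int D * x ^ k))"
      by (simp add: binomial_ring sum_distrib_left mult_ac)
    also have "\<dots> \<in> range val"
      by (intro range_val_sum range_val_mult[OF Ints_range_val] D) simp
    finally show "of_int D * (val (g + Golden C 0) / of_int C) ^ n \<in> range val"
      unfolding x1 .
  qed
  have "gnorm (g + Golden C 0) = gnorm g + C * (2 * a + b) + C\<^sup>2"
    by (simp add: g power2_eq_square algebra_simps)
  then have "C\<^sup>2 dvd C * (2 * a + b)"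
    using 1 2 by (metis dvd_add_right_iff dvd_add_left_iff dvd_refl)
  then have T: "C dvd 2 * a + b" using assms(2) by (simp add: power2_eq_square)
  have "(2 * a + b)\<^sup>2 - 5 * b\<^sup>2 = 4 * gnorm g"
    by (simp add: g power2_eq_square algebra_simps)
  then have "5 * b\<^sup>2 = (2 * a + b)\<^sup>2 - 4 * gnorm g" by simp
  moreover have "C\<^sup>2 dvd (2 * a + b)\<^sup>2" using T by (rule dvd_power_same)
  ultimately have 5: "C\<^sup>2 dvd 5 * b\<^sup>2" using 1 by simp
  have b: "C dvd b"
  proof -
    obtain C' b' where cb: "C = gcd C b * C'" "b = gcd C b * b'" "coprime C' b'"
      using gcd_coprime_exists[of C b] assms(2) by (metis mult.commute gcd_eq_0_iff less_irrefl)
    have g0: "gcd C b \<noteq> 0" using assms(2) by simp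
    have "(gcd C b)\<^sup>2 * C'\<^sup>2 dvd (gcd C b)\<^sup>2 * (5 * b'\<^sup>2)"
      using 5 cb(1,2) by (metis power_mult_distrib mult.left_commute)
    then have "C'\<^sup>2 dvd 5 * b'\<^sup>2" using g0 by auto
    then have "C'\<^sup>2 dvd 5" using cb(3) by (simp add: coprime_dvd_mult_left_iff)
    then have "C'\<^sup>2 \<le> 5" by (simp add: zdvd_imp_le)
    moreover have "C' \<noteq> 0" using cb(1) assms(2) by auto
    moreover have "3\<^sup>2 \<le> \<bar>C'\<bar>\<^sup>2" if "3 \<le> \<bar>C'\<bar>" using that by (intro power_mono) auto
    ultimately have "\<bar>C'\<bar> = 1 \<or> \<bar>C'\<bar> = 2" by fastforce
    moreover have "\<bar>C'\<bar> \<noteq> 2"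
    proof
      assume "\<bar>C'\<bar> = 2"
      then have "C'\<^sup>2 = 2\<^sup>2" by (metis power2_abs)
      then show False using \<open>C'\<^sup>2 dvd 5\<close> by simp
    qed
    ultimately have "C' = 1 \<or> C' = - 1" by linarith
    then have "C = gcd C b \<or> C = - gcd C b" using cb(1) by auto
    then show ?thesis by (metis gcd_dvd2 minus_dvd_iff)
  qed
  have "C dvd 2 * a" using T b by (simp add: dvd_add_left_iff)
  then obtain k where k: "2 * a = C * k" by (elim dvdE)
  obtain l where l: "b = C * l" using b by (elim dvdE)
  \<comment> \<open>So far only \<open>2 * a\<close> is known to be divisible by \<open>C\<close>;
    the norm modulo 2 shows that the cofactor \<open>k\<close> is even.\<close>
  have "4 * gnorm g = C\<^sup>2 * (k\<^sup>2 + 2 * k * l - 4 * l\<^sup>2)"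
  proof -
    have "4 * gnorm g = (2 * a)\<^sup>2 + 2 * (2 * a) * b - 4 * b\<^sup>2"
      by (simp add: g power2_eq_square algebra_simps)
    then show ?thesis unfolding k l by (simp add: power2_eq_square algebra_simps)
  qed
  moreover obtain j where "gnorm g = C\<^sup>2 * j" using 1 by (elim dvdE)
  ultimately have "C\<^sup>2 * (4 * j) = C\<^sup>2 * (k\<^sup>2 + 2 * k * l - 4 * l\<^sup>2)" by simp
  then have "4 * j = k\<^sup>2 + 2 * k * l - 4 * l\<^sup>2" using assms(2) by simp
  then have "k\<^sup>2 = 2 * (2 * j + 2 * l\<^sup>2 - k * l)" by (simp add: algebra_simps)
  then have "even (k\<^sup>2)" by (metis dvd_triv_left)
  then have "even k" by simp
  then obtain i where "k = 2 * i" by (elim evenE)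
  then have "a = C * i" using k by simp
  then have "val g / of_int C = val (Golden i l)"
    using assms(2) by (simp add: g l field_simps)
  then show ?thesis by (metis rangeI)
qed

lemma val_in_O_F: "val g \<in> O_F"
proof -
  obtain a b where g: "g = Golden a b" by (cases g)
  let ?p = "[:of_int (gnorm g), - of_int (2 * a + b), 1:] :: real poly"
  have "val g * val g - (2 * a + b) * val g + gnorm g = 0"
    unfolding gnorm_val by (simp add: g algebra_simps)
  then have "poly ?p (val g) = 0" by (simp add: algebra_simps)
  moreover have "coeff ?p i \<in> \<int>" for i
    by (auto simp: coeff_pCons split: nat.splits)
  ultimately have ai: "algebraic_int (val g)"
    by (intro algebraic_int.intros[of ?p]) auto
  have "val g = (a + b / 2) + (b / 2) * sqrt 5"
    by (simp add: g eps_def field_simps)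
  moreover have "real_of_int a + b / 2 \<in> \<rat>" "real_of_int b / 2 \<in> \<rat>" by simp_all
  ultimately have "val g \<in> field_F" unfolding field_F_def by blast
  with ai show ?thesis by (simp add: O_F_def)
qed

lemma O_F_eq: "O_F = range val"
proof
  show "range val \<subseteq> O_F" using val_in_O_F by blast
  show "O_F \<subseteq> range val"
  proof
    fix x assume "x \<in> O_F"
    then obtain r s where rs: "x = r + s * sqrt 5" "r \<in> \<rat>" "s \<in> \<rat>" and ai: "algebraic_int x"
      by (auto simp: O_F_def field_F_def)
    obtain a b where r: "r = of_int a / of_int b" "b > 0" using rs(2) by (rule Rats_cases')
    obtain c d where s: "s = of_int c / of_int d" "d > 0" using rs(3) by (rule Rats_cases')
    have "x = val (Golden (a * d - b * c) (2 * b * c)) / of_int (b * d)"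
      using r(2) s(2) by (simp add: rs(1) r(1) s(1) sqrt5_eps field_simps)
    moreover have "b * d > 0" using r s by simp
    ultimately show "x \<in> range val" using golden_integrally_closed ai by metis
  qed
qed

lemma E_F_eq: "E_F = val ` units"
proof
  show "E_F \<subseteq> val ` units"
  proof
    fix x assume "x \<in> E_F"
    then obtain g h where gh: "x = val g" "val g * val h = 1"
      by (auto simp: E_F_def O_F_eq)
    then have "val (g * h) = 1" by simp
    then have "g * h = 1" by (simp only: val_eq_1_iff)
    then have "height g * height h = 1" by (metis height_mult height_1)
    then show "x \<in> val ` units" using gh(1) height_1_imp_unit by auto
  qed
  show "val ` units \<subseteq> E_F"
  proof
    fix x assume "x \<in> val ` units"
    then obtain u where u: "u \<in> units" "x = val u" by blast
    obtain v where "u * v = 1" using units_inverse[OF u(1)] by blast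
    then have "val u * val v = 1" by (metis val_mult val_1)
    then show "x \<in> E_F" using u(2) by (auto simp: E_F_def O_F_eq)
  qed
qed

section \<open>Groups satisfying the relations\<close>

context group
begin

lemma inv_cancel_left [simp]:
  "x \<in> carrier G \<Longrightarrow> y \<in> carrier G \<Longrightarrow> inv x \<otimes> (x \<otimes> y) = y"
  "x \<in> carrier G \<Longrightarrow> y \<in> carrier G \<Longrightarrow> x \<otimes> (inv x \<otimes> y) = y"
  by (simp_all flip: m_assoc)

lemma intertwine_inv:
  assumes "x \<in> carrier G" "y \<in> carrier G" "z \<in> carrier G" "x \<otimes> y = z \<otimes> x"
  shows "x \<otimes> inv y = inv z \<otimes> x"
proof -
  have "inv z \<otimes> (x \<otimes> y) \<otimes> inv y = inv z \<otimes> (z \<otimes> x) \<otimes> inv y"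
    by (simp only: assms(4))
  then show ?thesis using assms(1-3) by (simp add: m_assoc)
qed

lemma intertwine_int_pow:
  assumes "x \<in> carrier G" "y \<in> carrier G" "z \<in> carrier G" "x \<otimes> y = z \<otimes> x"
  shows "x \<otimes> y [^] (k::int) = z [^] k \<otimes> x"
proof (induction k rule: int_induct[of _ 0])
  case (step1 i)
  have "x \<otimes> y [^] (i + 1) = (x \<otimes> y [^] i) \<otimes> y"
    using assms by (simp add: int_pow_mult m_assoc)
  also have "\<dots> = z [^] i \<otimes> (x \<otimes> y)" unfolding step1.IH using assms(1-3) by (simp add: m_assoc)
  also have "\<dots> = z [^] (i + 1) \<otimes> x"
    using assms(1-3) by (simp add: assms(4) int_pow_mult m_assoc)
  finally show ?case .
next
  case (step2 i)
  have "x \<otimes> y [^] (i - 1) = (x \<otimes> y [^] i) \<otimes> inv y"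
    using assms by (simp add: int_pow_diff m_assoc)
  also have "\<dots> = z [^] i \<otimes> (x \<otimes> inv y)" unfolding step2.IH using assms(1-3) by (simp add: m_assoc)
  also have "\<dots> = z [^] (i - 1) \<otimes> x"
    using assms(1-3) by (simp add: intertwine_inv[OF assms] int_pow_diff m_assoc)
  finally show ?case .
qed (use assms in simp)

end

text \<open>No faithfulness is assumed: the group may be any quotient of the free group in which the
  five relations hold.\<close>

locale hilbert_relations = group G for G (structure) +
  fixes s n t
  assumes s_closed [simp]: "s \<in> carrier G"
    and n_closed [simp]: "n \<in> carrier G"
    and t_closed [simp]: "t \<in> carrier G"
    and relations: "(l, r) \<in> relations_in G s n t \<Longrightarrow> l = r"
begin

lemma s_s [simp]: "s \<otimes> s = \<one>"
  using relations[of "s [^] (2::nat)" \<one>] by (simp add: relations_in_def numeral_2_eq_2)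

lemma s_s_left [simp]: "x \<in> carrier G \<Longrightarrow> s \<otimes> (s \<otimes> x) = x"
  by (simp flip: m_assoc)

lemma inv_s [simp]: "inv s = s"
  by (rule inv_equality) simp_all

lemma s_n: "s \<otimes> n = inv n \<otimes> s"
proof -
  have "(s \<otimes> n) \<otimes> (s \<otimes> n) = \<one>"
    using relations[of "(s \<otimes> n) [^] (2::nat)" \<one>] by (simp add: relations_in_def numeral_2_eq_2)
  then have "inv (s \<otimes> n) = s \<otimes> n" by (intro inv_equality) simp_all
  then show ?thesis by (simp add: inv_mult_group)
qed

lemma s_n_pow: "s \<otimes> n [^] (k::int) = n [^] (- k) \<otimes> s"
  using intertwine_int_pow[OF _ _ _ s_n, of k] by (simp add: int_pow_neg int_pow_inv)

lemma n_pow_s: "n [^] (k::int) \<otimes> s = s \<otimes> n [^] (- k)"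
  using s_n_pow[of "- k"] by simp

lemma s_t_s: "s \<otimes> (t \<otimes> s) = inv t \<otimes> (s \<otimes> inv t)"
proof -
  have "(s \<otimes> t) [^] (3::nat) = \<one>"
    using relations[of "(s \<otimes> t) [^] (3::nat)" \<one>] by (simp add: relations_in_def)
  then have "(s \<otimes> (t \<otimes> s)) \<otimes> (t \<otimes> (s \<otimes> t)) = \<one>" by (simp add: numeral_3_eq_3 m_assoc)
  then have "inv (t \<otimes> (s \<otimes> t)) = s \<otimes> (t \<otimes> s)" by (intro inv_equality) simp_all
  then show ?thesis by (simp add: inv_mult_group m_assoc)
qed

lemma s_inv_t_s: "s \<otimes> (inv t \<otimes> s) = t \<otimes> (s \<otimes> t)"
  using arg_cong[OF s_t_s, of "\<lambda>x. inv x"] by (simp add: inv_mult_group m_assoc)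

section \<open>Translations\<close>

definition t' where "t' = n \<otimes> t \<otimes> inv n"

lemma t'_closed [simp]: "t' \<in> carrier G"
  by (simp add: t'_def)

lemma t_t': "t \<otimes> t' = t' \<otimes> t"
  using relations[of "t \<otimes> n \<otimes> t \<otimes> inv n" "n \<otimes> t \<otimes> inv n \<otimes> t"]
  by (simp add: relations_in_def t'_def m_assoc)

lemma n_t: "n \<otimes> t = t' \<otimes> n"
  by (simp add: t'_def m_assoc)

text \<open>Relation (v') read as \<open>eps * eps = 1 + eps\<close>, with \<open>t\<close> the
  translation by 1 and \<open>t'\<close> the translation by \<open>eps\<close>.\<close>

lemma n_t': "n \<otimes> t' = (t \<otimes> t') \<otimes> n"
proof -
  have "n [^] (2::nat) \<otimes> t \<otimes> n [^] (- 2 :: int) = t \<otimes> n \<otimes> t \<otimes> inv n"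
    by (rule relations) (simp add: relations_in_def)
  moreover have "n [^] (- 2 :: int) = inv n \<otimes> inv n"
    using int_pow_neg_int[of n 2] by (simp add: numeral_2_eq_2 inv_mult_group)
  ultimately have "n \<otimes> (n \<otimes> (t \<otimes> (inv n \<otimes> inv n))) = t \<otimes> (n \<otimes> (t \<otimes> inv n))"
    by (simp add: numeral_2_eq_2 m_assoc)
  from arg_cong[OF this, of "\<lambda>x. x \<otimes> n"] show ?thesis
    by (simp add: t'_def m_assoc)
qed

fun T :: "golden \<Rightarrow> 'a" where
  "T (Golden a b) = t [^] a \<otimes> t' [^] b"

lemma T_closed [simp]: "T x \<in> carrier G"
  by (cases x) simp

lemma t_pow_t'_pow: "t [^] (i::int) \<otimes> t' [^] (j::int) = t' [^] j \<otimes> t [^] i"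
proof -
  have "t' \<otimes> t [^] i = t [^] i \<otimes> t'"
    by (rule intertwine_int_pow) (simp_all add: t_t')
  then show ?thesis by (intro intertwine_int_pow) simp_all
qed

lemma T_add: "T (x + y) = T x \<otimes> T y"
proof (cases x; cases y)
  fix a b c d assume [simp]: "x = Golden a b" "y = Golden c d"
  have "T x \<otimes> T y = t [^] a \<otimes> (t' [^] b \<otimes> t [^] c) \<otimes> t' [^] d" by (simp add: m_assoc)
  also have "\<dots> = T (x + y)" by (simp add: int_pow_mult m_assoc flip: t_pow_t'_pow)
  finally show ?thesis by simp
qed

lemma T_0 [simp]: "T 0 = \<one>"
  by (simp add: zero_golden_def)

lemma T_1 [simp]: "T 1 = t"
  by (simp add: one_golden_def)

lemma T_minus_1: "T (- 1) = inv t"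
  by (simp add: one_golden_def int_pow_neg)

text \<open>Conjugation by \<open>n\<close> sends \<open>t\<close> to \<open>t'\<close> and
  \<open>t'\<close> to \<open>t \<otimes> t'\<close>, which on coefficients takes
  \<open>(a, b)\<close> to \<open>(b, a + b)\<close>, that is, multiplication by
  \<open>eps\<close>.\<close>

lemma n_T: "n \<otimes> T x = T (epow 1 * x) \<otimes> n"
proof (cases x)
  case (Golden a b)
  have "n \<otimes> T x = (n \<otimes> t [^] a) \<otimes> t' [^] b" by (simp add: Golden m_assoc)
  also have "\<dots> = t' [^] a \<otimes> (n \<otimes> t' [^] b)"
    by (simp add: intertwine_int_pow[OF _ _ _ n_t] m_assoc)
  also have "\<dots> = t' [^] a \<otimes> ((t \<otimes> t') [^] b \<otimes> n)"
    by (simp add: intertwine_int_pow[OF _ _ _ n_t'])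
  also have "(t \<otimes> t') [^] b = t' [^] b \<otimes> t [^] b"
    by (simp add: int_pow_mult_distrib t_t' t_pow_t'_pow)
  also have "t' [^] a \<otimes> (t' [^] b \<otimes> t [^] b \<otimes> n) = (t' [^] (a + b) \<otimes> t [^] b) \<otimes> n"
    by (simp add: int_pow_mult m_assoc)
  also have "\<dots> = T (epow 1 * x) \<otimes> n"
    by (simp add: Golden epow_1 flip: t_pow_t'_pow)
  finally show ?thesis .
qed

lemma inv_n_T: "inv n \<otimes> T x = T (epow (- 1) * x) \<otimes> inv n"
proof -
  have "n \<otimes> T (epow (- 1) * x) = T x \<otimes> n"
    using n_T[of "epow (- 1) * x"] epow_mult_minus(1)[of 1] by (simp flip: mult.assoc)
  then have "inv n \<otimes> (n \<otimes> T (epow (- 1) * x)) \<otimes> inv n = inv n \<otimes> (T x \<otimes> n) \<otimes> inv n"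
    by simp
  then show ?thesis by (simp add: m_assoc)
qed

lemma n_pow_T: "n [^] (k::int) \<otimes> T x = T (epow k * x) \<otimes> n [^] k"
proof (induction k arbitrary: x rule: int_induct[of _ 0])
  case (step1 i)
  have "n [^] (i + 1) \<otimes> T x = n [^] i \<otimes> (n \<otimes> T x)" by (simp add: int_pow_mult m_assoc)
  also have "\<dots> = n [^] i \<otimes> T (epow 1 * x) \<otimes> n" by (simp add: n_T m_assoc)
  also have "\<dots> = T (epow (i + 1) * x) \<otimes> n [^] (i + 1)"
    unfolding step1.IH by (simp add: int_pow_mult m_assoc epow_add mult.assoc)
  finally show ?case .
next
  case (step2 i)
  have "n [^] (i - 1) \<otimes> T x = n [^] i \<otimes> (inv n \<otimes> T x)" by (simp add: int_pow_diff m_assoc)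
  also have "\<dots> = n [^] i \<otimes> T (epow (- 1) * x) \<otimes> inv n" by (simp add: inv_n_T m_assoc)
  also have "\<dots> = T (epow (i + (- 1)) * x) \<otimes> n [^] (i - 1)"
    unfolding step2.IH epow_add by (simp add: int_pow_diff m_assoc mult.assoc)
  finally show ?case by simp
qed simp

lemma T_n_pow: "T x \<otimes> n [^] (k::int) = n [^] k \<otimes> T (epow (- k) * x)"
  using n_pow_T[of k "epow (- k) * x"] by (simp flip: mult.assoc)

lemma T_conj: "T (epow k * x) = n [^] k \<otimes> T x \<otimes> n [^] (- k)"
  by (simp add: n_pow_T m_assoc flip: int_pow_mult)

lemma s_T_s_pm1:
  assumes "w = 1 \<or> w = - 1"
  shows "T w \<otimes> s = s \<otimes> (T (- w) \<otimes> (s \<otimes> T (- w)))"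
proof -
  have "s \<otimes> (T w \<otimes> s) = T (- w) \<otimes> (s \<otimes> T (- w))"
    using assms by (auto simp: T_minus_1 s_t_s s_inv_t_s)
  from arg_cong[OF this, of "\<lambda>x. s \<otimes> x"] show ?thesis by simp
qed

text \<open>The triangle relation for an arbitrary unit \<open>u = epow k * w\<close>. For
  \<open>k = 0\<close> it is (ii') or its inverse; the general case is its conjugate by a power of
  \<open>n\<close>, where \<open>s\<close> inverts that power and so leaves the factor
  \<open>n [^] (2 * k)\<close>.\<close>

lemma T_unit_s:
  assumes w: "w = 1 \<or> w = - 1"
  shows "T (epow k * w) \<otimes> s =
    s \<otimes> T (- (epow (- k) * w)) \<otimes> s \<otimes> n [^] (2 * k) \<otimes> T (- (epow (- k) * w))"
proof -
  let ?N = "n [^] k" and ?N' = "n [^] (- k)" and ?W = "T (- w)"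
  have NN [simp]: "?N \<otimes> (?N' \<otimes> x) = x" "?N' \<otimes> (?N \<otimes> x) = x" if "x \<in> carrier G" for x
    using that by (simp_all add: int_pow_neg)
  have W: "T (- (epow (- k) * w)) = ?N' \<otimes> (?W \<otimes> ?N)"
    using T_conj[of "- k" "- w"] by (simp add: m_assoc)
  have "T (epow k * w) \<otimes> s = ?N \<otimes> (T w \<otimes> (?N' \<otimes> s))" by (simp add: T_conj m_assoc)
  also have "\<dots> = ?N \<otimes> ((T w \<otimes> s) \<otimes> ?N)" by (simp add: n_pow_s m_assoc)
  also have "\<dots> = (?N \<otimes> s) \<otimes> (?W \<otimes> (s \<otimes> (?W \<otimes> ?N)))"
    unfolding s_T_s_pm1[OF w] by (simp add: m_assoc)
  also have "\<dots> = s \<otimes> (?N' \<otimes> (?W \<otimes> (s \<otimes> (?W \<otimes> ?N))))"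
    by (simp add: n_pow_s m_assoc)
  finally have l: "T (epow k * w) \<otimes> s = s \<otimes> (?N' \<otimes> (?W \<otimes> (s \<otimes> (?W \<otimes> ?N))))" .
  have "s \<otimes> T (- (epow (- k) * w)) \<otimes> s \<otimes> n [^] (2 * k) \<otimes> T (- (epow (- k) * w))
    = s \<otimes> (?N' \<otimes> (?W \<otimes> ((?N \<otimes> s) \<otimes> (n [^] (2 * k) \<otimes> (?N' \<otimes> (?W \<otimes> ?N))))))"
    unfolding W by (simp add: m_assoc)
  also have "n [^] (2 * k) \<otimes> (?N' \<otimes> (?W \<otimes> ?N)) = ?N \<otimes> (?W \<otimes> ?N)"
  proof -
    have "n [^] (2 * k) \<otimes> ?N' = ?N" by (simp flip: int_pow_mult)
    then show ?thesis by (simp flip: m_assoc)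
  qed
  also have "(?N \<otimes> s) \<otimes> (?N \<otimes> (?W \<otimes> ?N)) = s \<otimes> (?W \<otimes> ?N)"
    by (simp add: n_pow_s m_assoc)
  finally show ?thesis unfolding l by simp
qed

text \<open>\<open>D h a b c d\<close>: the element \<open>h\<close> lies over the matrix with rows \<open>(a, b)\<close>, \<open>(c, d)\<close> (up to
  units), and its cusp \<open>a / c\<close> is reached from \<open>\<infinity>\<close> along edges that increase the height of \<open>c\<close>.\<close>

inductive D :: "'a \<Rightarrow> golden \<Rightarrow> golden \<Rightarrow> golden \<Rightarrow> golden \<Rightarrow> bool" where
  one: "D \<one> 1 0 0 1"
| scale: "D h a b c d \<Longrightarrow> u \<in> units \<Longrightarrow> D h (u * a) (u * b) (u * c) (u * d)"
| pow_n: "D h a b c d \<Longrightarrow> D (h \<otimes> n [^] (k::int)) (epow k * a) b (epow k * c) d"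
| trans: "D h a b c d \<Longrightarrow> D (h \<otimes> T x) a (b + x * a) c (d + x * c)"
| ascend: "D h a b c d \<Longrightarrow> height c < height d \<Longrightarrow> D (h \<otimes> s) (- b) a (- d) c"

lemma D_closed: "D h a b c d \<Longrightarrow> h \<in> carrier G"
  by (induction rule: D.induct) auto

lemma D_nonzero: "D h a b c d \<Longrightarrow> c \<noteq> 0 \<or> d \<noteq> 0"
  by (induction rule: D.induct) (auto simp: units_def)

text \<open>An ascending edge ends at a nonzero denominator, and no other rule makes it vanish
  again. Over the cusp at infinity the path is therefore empty, and only powers of \<open>n\<close>
  and translations have been used.\<close>

lemma D_infinity:
  assumes "D h a b c d" "c = 0"
  shows "\<exists>k x u. u \<in> units \<and> h = n [^] (k::int) \<otimes> T x \<and> a = u * epow k \<and> b = u * (epow k * x) \<and> d = u"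
  using assms
proof (induction rule: D.induct)
  case one
  show ?case by (rule exI[of _ 0], rule exI[of _ 0], rule exI[of _ 1]) simp
next
  case (scale h a b c d u)
  then have "c = 0" by (auto simp: units_def)
  with scale obtain k x v where "v \<in> units" "h = n [^] (k::int) \<otimes> T x"
    "a = v * epow k" "b = v * (epow k * x)" "d = v" by blast
  with scale show ?case
    by (intro exI[of _ k] exI[of _ x] exI[of _ "u * v"]) (simp add: units_mult mult.assoc)
next
  case (pow_n h a b c d j)
  then obtain k x v where *: "v \<in> units" "h = n [^] (k::int) \<otimes> T x"
    "a = v * epow k" "b = v * (epow k * x)" "d = v" by auto
  have "h \<otimes> n [^] j = n [^] (k + j) \<otimes> T (epow (- j) * x)"
    by (simp add: * m_assoc T_n_pow int_pow_mult)
  moreover have "epow (k + j) * (epow (- j) * x) = epow k * x"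
    unfolding mult.assoc[symmetric] by (simp flip: epow_add)
  ultimately show ?case using *
    by (intro exI[of _ "k + j"] exI[of _ "epow (- j) * x"] exI[of _ v])
      (simp add: epow_add mult_ac)
next
  case (trans h a b c d y)
  then obtain k x v where *: "v \<in> units" "h = n [^] (k::int) \<otimes> T x"
    "a = v * epow k" "b = v * (epow k * x)" "d = v" "c = 0" by blast
  then show ?case
    by (intro exI[of _ k] exI[of _ "x + y"] exI[of _ v]) (simp add: T_add m_assoc algebra_simps)
qed auto

text \<open>Recovers the lower cusp from which the last ascending edge came. Later scalings, powers
  of \<open>n\<close> and translations fix the current cusp and merely reparametrise its neighbours,
  so the parameter \<open>x\<close> is carried along.\<close>

lemma D_parent:
  assumes "D h a b c d" "c \<noteq> 0"
  shows "\<exists>x. D (h \<otimes> T x \<otimes> s) (- (b + x * a)) a (- (d + x * c)) c \<and> height (d + x * c) < height c"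
  using assms
proof (induction rule: D.induct)
  case (scale h a b c d u)
  then have "c \<noteq> 0" by auto
  with scale obtain x where x: "D (h \<otimes> T x \<otimes> s) (- (b + x * a)) a (- (d + x * c)) c"
    "height (d + x * c) < height c" by blast
  have "u * d + x * (u * c) = u * (d + x * c)" by (simp add: algebra_simps)
  then have "height (u * d + x * (u * c)) < height (u * c)"
    using x(2) scale.hyps(2) by simp
  moreover have "D (h \<otimes> T x \<otimes> s) (- (u * b + x * (u * a))) (u * a) (- (u * d + x * (u * c))) (u * c)"
    using D.scale[OF x(1) scale.hyps(2)] by (simp add: algebra_simps)
  ultimately show ?case by blast
next
  case (pow_n h a b c d k)
  then have "c \<noteq> 0" by auto
  with pow_n obtain x where x: "D (h \<otimes> T x \<otimes> s) (- (b + x * a)) a (- (d + x * c)) c"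
    "height (d + x * c) < height c" by blast
  have h: "h \<in> carrier G" using D_closed[OF pow_n.hyps] .
  let ?y = "epow (- k) * x"
  have y: "?y * (epow k * z) = x * z" for z
  proof -
    have "?y * (epow k * z) = (epow (- k) * epow k) * (x * z)" by (simp only: mult_ac)
    then show ?thesis by simp
  qed
  have g: "h \<otimes> n [^] k \<otimes> T ?y \<otimes> s = h \<otimes> T x \<otimes> s \<otimes> n [^] (- k)"
    using h by (simp add: m_assoc flip: T_n_pow) (simp add: n_pow_s)
  have z: "epow k * (epow (- k) * z) = z" for z by (simp flip: mult.assoc)
  have "D (h \<otimes> n [^] k \<otimes> T ?y \<otimes> s) (- (b + ?y * (epow k * a))) (epow k * a)
      (- (d + ?y * (epow k * c))) (epow k * c)"
    using D.scale[OF D.pow_n[OF x(1), of "- k"], of "epow k"]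
    unfolding g y by (simp only: z epow_in_units simp_thms)
  moreover have "height (d + ?y * (epow k * c)) < height (epow k * c)"
    using x(2) unfolding y by simp
  ultimately show ?case by blast
next
  case (trans h a b c d y)
  then obtain x where x: "D (h \<otimes> T x \<otimes> s) (- (b + x * a)) a (- (d + x * c)) c"
    "height (d + x * c) < height c" by blast
  have h: "h \<in> carrier G" using D_closed[OF trans.hyps] .
  have "T y \<otimes> T (x - y) = T x" by (simp flip: T_add)
  then have g: "h \<otimes> T y \<otimes> T (x - y) \<otimes> s = h \<otimes> T x \<otimes> s" using h by (simp add: m_assoc)
  show ?case
    using x by (intro exI[of _ "x - y"]) (simp add: g algebra_simps)
next
  case (ascend h a b c d)
  have h: "h \<in> carrier G" using D_closed[OF ascend.hyps(1)] .
  \<comment> \<open>Going back along the edge applies \<open>s\<close> twice: this is trivial in the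
    group, but the matrix gets negated.\<close>
  have "D h (- a) (- b) (- c) (- d)"
    using D.scale[OF ascend.hyps(1), of "- 1"] by (simp add: units_uminus)
  then show ?case using ascend.hyps(2) h by (intro exI[of _ 0]) (simp add: m_assoc)
qed simp

text \<open>The triangle \<open>\<infinity>, 0, u\<close>: one edge of it can be replaced by the other two.\<close>

lemma D_triangle:
  assumes h: "h \<in> carrier G" and u: "u \<in> units" "u * v = 1"
    and D: "D (h \<otimes> s \<otimes> T (- v) \<otimes> s) (- (a + v * b)) (- b) (- (c + v * d)) (- d)"
  shows "D (h \<otimes> T u \<otimes> s) (- (b + u * a)) a (- (d + u * c)) c"
proof -
  obtain k w where uk: "u = epow k * w" and w: "w = 1 \<or> w = - 1"
    using u(1) unfolding units_def by force
  have ww: "w * w = 1" using w by auto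
  have "u * (epow (- k) * w) = (epow k * epow (- k)) * (w * w)" unfolding uk by (simp only: mult_ac)
  then have "u * (epow (- k) * w) = 1" by (simp add: ww)
  then have vk: "v = epow (- k) * w"
    using u(2) by (metis mult.commute mult.left_commute mult_1_right)
  have v: "v \<in> units" using w by (auto simp: vk units_uminus)
  have "u * u = (epow k * epow k) * (w * w)" unfolding uk by (simp only: mult_ac)
  then have e2: "epow (2 * k) = u * u" by (simp add: ww epow_add[symmetric])
  have g: "h \<otimes> T u \<otimes> s = h \<otimes> s \<otimes> T (- v) \<otimes> s \<otimes> n [^] (2 * k) \<otimes> T (- v)"
    using T_unit_s[OF w, of k] h unfolding uk[symmetric] vk[symmetric] by (simp add: m_assoc)
  have "D (h \<otimes> T u \<otimes> s) (v * (epow (2 * k) * - (a + v * b)))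
      (v * (- b + - v * (epow (2 * k) * - (a + v * b))))
      (v * (epow (2 * k) * - (c + v * d)))
      (v * (- d + - v * (epow (2 * k) * - (c + v * d))))"
    unfolding g by (intro D.scale D.trans D.pow_n D v)
  moreover have "v * (epow (2 * k) * - (x + v * y)) = - (y + u * x)" for x y
    unfolding e2 using u(2) by algebra
  moreover have "v * (- y + - v * (epow (2 * k) * - (x + v * y))) = x" for x y
    unfolding e2 using u(2) by algebra
  ultimately show ?thesis by (simp only:)
qed

text \<open>Here paths are pushed down, by induction on the larger height of the edge. A descending
  edge is compared with the edge to the parent by walking through the lower neighbours; a level edge
  is replaced by two edges through a cusp below both ends.\<close>

lemma D_s: "D h a b c d \<Longrightarrow> D (h \<otimes> s) (- b) a (- d) c"
proof (induction "max (height c) (height d)" arbitrary: h a b c d rule: less_induct)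
  case less
  define m where "m = max (height c) (height d)"
  have descend: "D (h \<otimes> s) (- b) a (- d) c"
    if D: "D h a b c d" and m: "height c = m" and lt: "height d < height c" for h a b c d
  proof -
    have h: "h \<in> carrier G" using D_closed[OF D] .
    have c: "c \<noteq> 0" using lt by auto
    obtain x0 where x0: "D (h \<otimes> T x0 \<otimes> s) (- (b + x0 * a)) a (- (d + x0 * c)) c"
      "height (d + x0 * c) < height c"
      using D_parent[OF D c] by blast
    have lt0: "height (d + 0 * c) < height c" using lt by simp
    \<comment> \<open>The parent has parameter \<open>x0\<close>, for which the claim is known; the
      wanted edge has parameter 0. Both belong to lower neighbours of the same cusp.\<close>
    from c x0(2) lt0 have "D (h \<otimes> T 0 \<otimes> s) (- (b + 0 * a)) a (- (d + 0 * c)) c"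
    proof (induction rule: descending_induct)
      case start
      show ?case by (rule x0)
    next
      case (step x u)
      obtain v where v: "v \<in> units" "u * v = 1" "v * u = 1" using units_inverse[OF step(2)] .
      have eq: "c + v * (d + x * c) = v * (d + (x + u) * c)"
        using v(2) by algebra
      have "D (h \<otimes> T x \<otimes> s \<otimes> T (- v)) (- (b + x * a)) (a + - v * - (b + x * a))
          (- (d + x * c)) (c + - v * - (d + x * c))"
        by (rule D.trans[OF step(1)])
      then have D1: "D (h \<otimes> T x \<otimes> s \<otimes> T (- v)) (- (b + x * a)) (a + v * (b + x * a))
          (- (d + x * c)) (c + v * (d + x * c))" by (simp only: minus_mult_minus)
      \<comment> \<open>By \<open>eq\<close> the second denominator is a unit times that of the next
        neighbour. The edge joining the two neighbours thus lies entirely below the current cusp,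
        and the induction hypothesis covers it.\<close>
      have "max (height (- (d + x * c))) (height (c + v * (d + x * c))) < m"
        unfolding eq height_uminus using step(3,4) v(1) m by simp
      then have "D (h \<otimes> T x \<otimes> s \<otimes> T (- v) \<otimes> s) (- (a + v * (b + x * a))) (- (b + x * a))
          (- (c + v * (d + x * c))) (- (d + x * c))"
        using less.hyps[OF _ D1] by (simp add: m_def)
      then have "D (h \<otimes> T x \<otimes> T u \<otimes> s) (- (b + x * a + u * a)) a (- (d + x * c + u * c)) c"
        by (intro D_triangle[OF _ step(2) v(2)]) (use h in simp_all)
      moreover have "h \<otimes> T x \<otimes> T u = h \<otimes> T (x + u)" using h by (simp add: T_add m_assoc)
      ultimately show ?case by (simp only: distrib_right add.assoc)
    qed
    then show ?thesis using h by simp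
  qed
  consider "height c < height d" | "height d < height c" | "height d = height c" by linarith
  then show ?case
  proof cases
    case 1
    then show ?thesis using less.prems by (intro D.ascend)
  next
    case 2
    then show ?thesis using descend[OF less.prems] by (simp add: m_def)
  next
    case 3
    have h: "h \<in> carrier G" using D_closed[OF less.prems] .
    have "height c \<noteq> 0" using D_nonzero[OF less.prems] 3 by (metis height_eq_0_iff)
    then have "c \<noteq> 0" "d \<noteq> 0" using 3 by auto
    then obtain u where u: "u \<in> units" "height (d + u * c) < height c"
      using unit_descent[of c d] 3 by auto
    obtain v where v: "v \<in> units" "u * v = 1" "v * u = 1" using units_inverse[OF u(1)] .
    \<comment> \<open>The way down to the third cusp is a descending edge whose larger height is
      still \<open>m\<close>, so \<open>descend\<close> applies, not the induction
      hypothesis.\<close>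
    have "D (h \<otimes> T u \<otimes> s) (- (b + u * a)) a (- (d + u * c)) c"
      using descend[OF D.trans[OF less.prems, of u]] u(2) 3 by (simp add: m_def)
    from D.trans[OF this, of v]
    have D1: "D (h \<otimes> T u \<otimes> s \<otimes> T v) (- (b + u * a)) (a - v * (b + u * a))
        (- (d + u * c)) (c - v * (d + u * c))"
      by (simp only: mult_minus_right add_uminus_conv_diff)
    \<comment> \<open>From the third cusp the edge to the other end of the level edge goes up, so
      the rule \<open>ascend\<close> suffices; the triangle for \<open>- u\<close> then returns to
      the original edge.\<close>
    have "c - v * (d + u * c) = - v * d" using v(2) by algebra
    then have "height (c - v * (d + u * c)) = height c" using v(1) 3 by simp
    then have "D (h \<otimes> T u \<otimes> s \<otimes> T v \<otimes> s) (- (a - v * (b + u * a))) (- (b + u * a))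
        (- (c - v * (d + u * c))) (- (d + u * c))"
      using D.ascend[OF D1] u(2) by (simp only: height_uminus minus_minus)
    then have "D (h \<otimes> T u \<otimes> T (- u) \<otimes> s) (- (b + u * a + - u * a)) a (- (d + u * c + - u * c)) c"
      using h v u(1) by (intro D_triangle[where v = "- v"])
        (simp_all only: minus_minus mult_minus_left mult_minus_right add_uminus_conv_diff
          units_uminus m_closed T_closed)
    moreover have "T u \<otimes> T (- u) = \<one>" by (simp flip: T_add)
    ultimately show ?thesis using h by (simp add: m_assoc)
  qed
qed

text \<open>A scalar matrix fixes infinity, so \<open>h\<close> is a power of \<open>n\<close> times
  a translation; the zero corner removes the translation, and equality of the diagonal entries
  removes the power, as \<open>eps\<close> has infinite order.\<close>

lemma D_scalar_imp_one:
  assumes "D h a 0 0 a"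
  shows "h = \<one>"
proof -
  obtain k x u where *: "u \<in> units" "h = n [^] (k::int) \<otimes> T x" "a = u * epow k"
    "0 = u * (epow k * x)" "a = u"
    using D_infinity[OF assms] by blast
  have "u \<noteq> 0" using *(1) by (auto simp: units_def)
  then have x: "x = 0" using *(4) by auto
  have "val u * eps powi k = val u" using *(3,5) by (metis val_mult val_epow)
  then have "eps powi k = 1" using \<open>u \<noteq> 0\<close> by simp
  then have "k = 0"
    using power_int_strict_increasing[of 0 k eps] power_int_strict_increasing[of k 0 eps] eps_bounds
    by (cases k "0 :: int" rule: linorder_cases) auto
  then show ?thesis using * x by simp
qed

end

section \<open>Matrices over \<open>\<int>[\<epsilon>]\<close> and the group \<open>\<Gamma>\<^sup>*\<close>\<close>

definition gmat :: "golden \<Rightarrow> golden \<Rightarrow> golden \<Rightarrow> golden \<Rightarrow> real^2^2" where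
  "gmat a b c d = vector [vector [val a, val b], vector [val c, val d]]"

lemma gmat_mult:
  "gmat a b c d ** gmat a' b' c' d' =
    gmat (a * a' + b * c') (a * b' + b * d') (c * a' + d * c') (c * b' + d * d')"
  by (simp add: gmat_def vec_eq_iff matrix_matrix_mult_def forall_2 sum_2)

lemma gmat_one: "gmat 1 0 0 1 = mat 1"
  by (simp add: gmat_def vec_eq_iff mat_def forall_2)

lemma gmat_inject: "gmat a b c d = gmat a' b' c' d' \<longleftrightarrow> a = a' \<and> b = b' \<and> c = c' \<and> d = d'"
  by (auto simp: gmat_def vec_eq_iff forall_2)

lemma det_gmat: "det (gmat a b c d) = val (a * d - b * c)"
  by (simp add: det_2 gmat_def)

lemma carrier_M2_OF: "carrier M2_OF = {gmat a b c d | a b c d. True}"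
proof (intro equalityI subsetI)
  fix A assume "A \<in> carrier M2_OF"
  then have "\<exists>g. A $ i $ j = val g" for i j
    by (auto simp: M2_OF_def O_F_eq)
  then obtain f where "A $ i $ j = val (f i j)" for i j by metis
  then have "A = gmat (f 1 1) (f 1 2) (f 2 1) (f 2 2)"
    by (simp add: gmat_def vec_eq_iff forall_2)
  then show "A \<in> {gmat a b c d | a b c d. True}" by blast
qed (auto simp: M2_OF_def O_F_eq gmat_def forall_2)

definition eps_det :: "golden \<Rightarrow> golden \<Rightarrow> golden \<Rightarrow> golden \<Rightarrow> bool" where
  "eps_det a b c d \<longleftrightarrow> (\<exists>k. a * d - b * c = epow k)"

lemma eps_det_mult:
  assumes "eps_det a b c d" "eps_det a' b' c' d'"
  shows "eps_det (a * a' + b * c') (a * b' + b * d') (c * a' + d * c') (c * b' + d * d')"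
proof -
  obtain j k where "a * d - b * c = epow j" "a' * d' - b' * c' = epow k"
    using assms by (auto simp: eps_det_def)
  then have "epow (j + k) = (a * d - b * c) * (a' * d' - b' * c')" by (simp add: epow_add)
  also have "\<dots> = (a * a' + b * c') * (c * b' + d * d') - (a * b' + b * d') * (c * a' + d * c')"
    by (simp add: algebra_simps)
  finally show ?thesis unfolding eps_det_def by metis
qed

lemma gmat_inverse:
  assumes "a * d - b * c = epow k"
  defines "e \<equiv> epow (- k)"
  shows "gmat a b c d ** gmat (e * d) (- (e * b)) (- (e * c)) (e * a) = mat 1"
    and "gmat (e * d) (- (e * b)) (- (e * c)) (e * a) ** gmat a b c d = mat 1"
    and "eps_det (e * d) (- (e * b)) (- (e * c)) (e * a)"
proof -
  have e: "e * (a * d - b * c) = 1" by (simp add: assms)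
  show "gmat a b c d ** gmat (e * d) (- (e * b)) (- (e * c)) (e * a) = mat 1"
    "gmat (e * d) (- (e * b)) (- (e * c)) (e * a) ** gmat a b c d = mat 1"
    using e unfolding gmat_mult gmat_one[symmetric] gmat_inject by (auto simp: algebra_simps)
  have "e * d * (e * a) - - (e * b) * - (e * c) = e * (e * (a * d - b * c))"
    by (simp add: algebra_simps)
  also have "\<dots> = epow (- k)" unfolding e by (simp add: e_def)
  finally show "eps_det (e * d) (- (e * b)) (- (e * c)) (e * a)" unfolding eps_det_def by blast
qed

lemma Gamma_bar_eq: "Gamma_bar = {gmat a b c d | a b c d. eps_det a b c d}"
proof (intro equalityI subsetI)
  fix A assume "A \<in> Gamma_bar"
  then have "A \<in> carrier M2_OF" and "\<exists>n::int. det A = eps powi n"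
    by (auto simp: Gamma_bar_def GL2_OF_def units_of_def Units_def)
  then obtain a b c d n where A: "A = gmat a b c d" and "det A = eps powi n"
    by (auto simp: carrier_M2_OF)
  then have "val (a * d - b * c) = val (epow n)" by (simp only: det_gmat val_epow)
  then have "a * d - b * c = epow n" by (simp only: val_inject)
  then have "eps_det a b c d" unfolding eps_det_def by blast
  then show "A \<in> {gmat a b c d | a b c d. eps_det a b c d}" using A by blast
next
  fix A assume "A \<in> {gmat a b c d | a b c d. eps_det a b c d}"
  then obtain a b c d k where A: "A = gmat a b c d" and k: "a * d - b * c = epow k"
    by (auto simp: eps_det_def)
  have "mult M2_OF = (**)" "one M2_OF = mat 1" by (simp_all add: M2_OF_def)
  then have "A \<in> carrier GL2_OF"
    using gmat_inverse(1,2)[OF k] unfolding A GL2_OF_def units_of_def Units_def carrier_M2_OF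
    by simp blast
  then show "A \<in> Gamma_bar"
    using k by (auto simp: Gamma_bar_def A det_gmat simp del: val_diff val_mult)
qed

lemma Z_scalars_eq: "Z_scalars = {gmat u 0 0 u | u. u \<in> units}"
proof -
  have "val u *\<^sub>R mat 1 = gmat u 0 0 u" for u
    by (simp add: gmat_def vec_eq_iff mat_def forall_2)
  then show ?thesis unfolding Z_scalars_def E_F_eq by (smt (verit) Collect_cong image_iff)
qed

definition GammaL :: "(real^2^2) monoid" where
  "GammaL = GL2_OF\<lparr>carrier := Gamma_bar\<rparr>"

lemma mult_GL2_OF [simp]: "mult GL2_OF = (**)"
  by (simp add: GL2_OF_def units_of_def M2_OF_def)

lemma GammaL_simps [simp]:
  "carrier GammaL = Gamma_bar" "mult GammaL = (**)" "one GammaL = mat 1"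
  by (simp_all add: GammaL_def GL2_OF_def units_of_def M2_OF_def)

lemma gmat_in_Gamma_bar: "gmat a b c d \<in> Gamma_bar \<longleftrightarrow> eps_det a b c d"
  by (auto simp: Gamma_bar_eq gmat_inject)

lemma eps_det_unit_scalar:
  assumes "u \<in> units"
  shows "eps_det u 0 0 u"
proof -
  obtain k where "u = epow k \<or> u = - epow k" using assms by (auto simp: units_def)
  then have "u * u = epow (k + k)" unfolding epow_add by auto
  then show ?thesis unfolding eps_det_def by auto
qed

lemma one_Z: "mat 1 \<in> Z_scalars"
  by (auto simp: Z_scalars_eq simp flip: gmat_one)

text \<open>A scalar unit matrix has determinant the square of a unit, which is a power of
  \<open>eps\<close> without sign, so the scalars already lie in \<open>Gamma_bar\<close>.\<close>

lemma Z_Gamma_bar: "Z_scalars <#>\<^bsub>GL2_OF\<^esub> Gamma_bar = Gamma_bar"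
proof
  show "Z_scalars <#>\<^bsub>GL2_OF\<^esub> Gamma_bar \<subseteq> Gamma_bar"
  proof
    fix A assume "A \<in> Z_scalars <#>\<^bsub>GL2_OF\<^esub> Gamma_bar"
    then obtain u a b c d where "u \<in> units" "eps_det a b c d" "A = gmat u 0 0 u ** gmat a b c d"
      by (auto simp: set_mult_def Z_scalars_eq Gamma_bar_eq)
    then show "A \<in> Gamma_bar"
      using eps_det_mult[OF eps_det_unit_scalar] by (simp only: gmat_mult gmat_in_Gamma_bar)
  qed
  show "Gamma_bar \<subseteq> Z_scalars <#>\<^bsub>GL2_OF\<^esub> Gamma_bar"
  proof
    fix A assume "A \<in> Gamma_bar"
    then show "A \<in> Z_scalars <#>\<^bsub>GL2_OF\<^esub> Gamma_bar"
      using one_Z matrix_mul_lid[of A] unfolding set_mult_def mult_GL2_OF by blast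
  qed
qed

lemma Gamma_star_eq: "Gamma_star = GammaL Mod Z_scalars"
  unfolding Gamma_star_def Z_Gamma_bar GammaL_def ..

lemma group_GammaL: "group GammaL"
proof (rule groupI)
  show "A \<otimes>\<^bsub>GammaL\<^esub> B \<in> carrier GammaL" if "A \<in> carrier GammaL" "B \<in> carrier GammaL" for A B
    using that eps_det_mult unfolding GammaL_simps Gamma_bar_eq by (force simp: gmat_mult)
  show "\<one>\<^bsub>GammaL\<^esub> \<in> carrier GammaL"
    using eps_det_unit_scalar[of 1] by (simp add: gmat_in_Gamma_bar flip: gmat_one)
  show "\<exists>B\<in>carrier GammaL. B \<otimes>\<^bsub>GammaL\<^esub> A = \<one>\<^bsub>GammaL\<^esub>" if "A \<in> carrier GammaL" for A
  proof -
    obtain a b c d k where A: "A = gmat a b c d" "a * d - b * c = epow k"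
      using \<open>A \<in> carrier GammaL\<close> by (auto simp: Gamma_bar_eq eps_det_def)
    then show ?thesis using gmat_inverse[OF A(2)] gmat_in_Gamma_bar unfolding GammaL_simps by metis
  qed
qed (simp_all add: matrix_mul_assoc)

lemma normal_Z: "Z_scalars \<lhd> GammaL"
proof -
  interpret group GammaL by (rule group_GammaL)
  have sub: "Z_scalars \<subseteq> Gamma_bar"
    by (auto simp: Z_scalars_eq gmat_in_Gamma_bar eps_det_unit_scalar)
  have "subgroup Z_scalars GammaL"
  proof (rule subgroup.intro)
    show "inv\<^bsub>GammaL\<^esub> A \<in> Z_scalars" if A: "A \<in> Z_scalars" for A
    proof -
      obtain u where u: "u \<in> units" "A = gmat u 0 0 u" using A by (auto simp: Z_scalars_eq)
      obtain v where v: "v \<in> units" "v * u = 1" using units_inverse[OF u(1)] by metis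
      have "inv\<^bsub>GammaL\<^esub> A = gmat v 0 0 v"
        using u v by (intro inv_equality)
          (simp_all add: gmat_mult gmat_one gmat_in_Gamma_bar eps_det_unit_scalar)
      then show ?thesis using v(1) by (auto simp: Z_scalars_eq)
    qed
  qed (use sub one_Z in \<open>auto simp: Z_scalars_eq gmat_mult gmat_inject units_mult\<close>)
  moreover have "Z_scalars #>\<^bsub>GammaL\<^esub> A = A <#\<^bsub>GammaL\<^esub> Z_scalars" if A: "A \<in> carrier GammaL" for A
  proof -
    obtain a b c d where "A = gmat a b c d" using A by (auto simp: Gamma_bar_eq)
    then have "B ** A = A ** B" if "B \<in> Z_scalars" for B
      using that by (auto simp: Z_scalars_eq gmat_mult mult.commute)
    then show ?thesis by (auto simp: r_coset_def l_coset_def)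
  qed
  ultimately show ?thesis by (intro normalI) auto
qed

lemma group_Gamma_star: "group Gamma_star"
  unfolding Gamma_star_eq by (rule normal.factorgroup_is_group[OF normal_Z])

interpretation Gamma_star: group Gamma_star
  by (rule group_Gamma_star)

definition pgl :: "golden \<Rightarrow> golden \<Rightarrow> golden \<Rightarrow> golden \<Rightarrow> (real^2^2) set" where
  "pgl a b c d = image_in_PGL (gmat a b c d)"

lemma pgl_coset: "pgl a b c d = Z_scalars #>\<^bsub>GammaL\<^esub> gmat a b c d"
  by (simp add: pgl_def image_in_PGL_def r_coset_def)

lemma carrier_Gamma_star: "carrier Gamma_star = {pgl a b c d | a b c d. eps_det a b c d}"
  unfolding Gamma_star_eq carrier_FactGroup pgl_coset GammaL_simps Gamma_bar_eq by blast

lemma pgl_closed: "eps_det a b c d \<Longrightarrow> pgl a b c d \<in> carrier Gamma_star"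
  by (auto simp: carrier_Gamma_star)

lemma pgl_mult:
  assumes "eps_det a b c d" "eps_det a' b' c' d'"
  shows "pgl a b c d \<otimes>\<^bsub>Gamma_star\<^esub> pgl a' b' c' d' =
    pgl (a * a' + b * c') (a * b' + b * d') (c * a' + d * c') (c * b' + d * d')"
  using normal.rcos_sum[OF normal_Z, of "gmat a b c d" "gmat a' b' c' d'"] assms
  by (simp add: Gamma_star_eq pgl_coset gmat_in_Gamma_bar gmat_mult)

lemma one_Gamma_star: "\<one>\<^bsub>Gamma_star\<^esub> = Z_scalars"
  by (simp add: Gamma_star_eq)

lemma pgl_unit: "u \<in> units \<Longrightarrow> pgl u 0 0 u = \<one>\<^bsub>Gamma_star\<^esub>"
  unfolding one_Gamma_star pgl_coset
  using normal_imp_subgroup[OF normal_Z]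
  by (intro group.coset_join2[OF group_GammaL])
    (auto simp: Z_scalars_eq gmat_in_Gamma_bar eps_det_unit_scalar)

lemma pgl_eq_one:
  assumes "pgl a b c d = \<one>\<^bsub>Gamma_star\<^esub>"
  shows "b = 0 \<and> c = 0 \<and> a = d"
proof -
  have "gmat a b c d \<in> pgl a b c d"
    using one_Z by (force simp: pgl_coset r_coset_def)
  then show ?thesis using assms by (auto simp: one_Gamma_star Z_scalars_eq gmat_inject)
qed

lemma pgl_scale:
  assumes "u \<in> units" "eps_det a b c d"
  shows "pgl (u * a) (u * b) (u * c) (u * d) = pgl a b c d"
proof -
  have "pgl u 0 0 u \<otimes>\<^bsub>Gamma_star\<^esub> pgl a b c d = pgl a b c d"
    using pgl_closed[OF assms(2)] by (simp add: pgl_unit[OF assms(1)])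
  then show ?thesis using pgl_mult[OF eps_det_unit_scalar[OF assms(1)] assms(2)] by simp
qed

lemma sigma_pgl: "sigma = pgl 0 1 (- 1) 0"
  by (simp add: sigma_def pgl_def gmat_def)

lemma nu_pgl: "nu = pgl (epow 1) 0 0 1"
  by (simp add: nu_def pgl_def gmat_def)

lemma tau_pgl: "tau = pgl 1 1 0 1"
  by (simp add: tau_def pgl_def gmat_def)

lemma eps_det_simps [simp]:
  "eps_det 0 1 (- 1) 0" "eps_det 1 x 0 1" "eps_det (epow k) x 0 1"
  by (auto simp: eps_det_def intro: exI[of _ 0])

lemma generators_closed [simp]:
  "sigma \<in> carrier Gamma_star" "nu \<in> carrier Gamma_star" "tau \<in> carrier Gamma_star"
  by (simp_all add: sigma_pgl nu_pgl tau_pgl pgl_closed)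

lemma inv_nu: "inv\<^bsub>Gamma_star\<^esub> nu = pgl (epow (- 1)) 0 0 1"
  by (rule Gamma_star.inv_equality)
    (simp_all add: nu_pgl pgl_closed pgl_mult pgl_unit)

lemma inv_tau: "inv\<^bsub>Gamma_star\<^esub> tau = pgl 1 (- 1) 0 1"
  by (rule Gamma_star.inv_equality) (simp_all add: tau_pgl pgl_closed pgl_mult pgl_unit)

section \<open>Generation by the Euclidean algorithm\<close>

lemma Gamma_star_generated: "generate Gamma_star {sigma, nu, tau} = carrier Gamma_star"
proof
  let ?H = "generate Gamma_star {sigma, nu, tau}"
  show "?H \<subseteq> carrier Gamma_star"
    by (rule Gamma_star.generate_incl) simp
  have mult: "pgl (a * a' + b * c') (a * b' + b * d') (c * a' + d * c') (c * b' + d * d') \<in> ?H"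
    if "pgl a b c d \<in> ?H" "pgl a' b' c' d' \<in> ?H" "eps_det a b c d" "eps_det a' b' c' d'"
    for a b c d a' b' c' d'
    using generate.eng[OF that(1,2)] by (simp add: pgl_mult[OF that(3,4)])
  have gens: "pgl 0 1 (- 1) 0 \<in> ?H" "pgl (epow 1) 0 0 1 \<in> ?H" "pgl 1 1 0 1 \<in> ?H"
    "pgl (epow (- 1)) 0 0 1 \<in> ?H" "pgl 1 (- 1) 0 1 \<in> ?H"
    unfolding sigma_pgl[symmetric] nu_pgl[symmetric] tau_pgl[symmetric]
      inv_nu[symmetric] inv_tau[symmetric]
    by (auto intro: generate.incl generate.inv)
  have one: "pgl 1 0 0 1 \<in> ?H" using generate.one by (simp add: pgl_unit)
  have pow: "pgl (epow k) 0 0 1 \<in> ?H" for k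
  proof (induction k rule: int_induct[of _ 0])
    case (step1 i)
    from mult[OF step1.IH gens(2)] show ?case by (simp add: epow_add)
  next
    case (step2 i)
    from mult[OF step2.IH gens(4)] show ?case
      using epow_add[of i "- 1"] by simp
  qed (simp add: one)
  have add: "pgl 1 (x + y) 0 1 \<in> ?H" if "pgl 1 x 0 1 \<in> ?H" "pgl 1 y 0 1 \<in> ?H" for x y
    using mult[OF that] by (simp add: add.commute)
  have int: "pgl 1 (Golden i 0) 0 1 \<in> ?H" for i
  proof (induction i rule: int_induct[of _ 0])
    case base
    show ?case using one by (simp flip: zero_golden_def)
  next
    case (step1 i)
    from add[OF step1.IH gens(3)] show ?case by (simp add: one_golden_def)
  next
    case (step2 i)
    from add[OF step2.IH gens(5)] show ?case by (simp add: one_golden_def)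
  qed
  have conj: "pgl 1 (epow k * x) 0 1 \<in> ?H" if "pgl 1 x 0 1 \<in> ?H" for k x
    using mult[OF mult[OF pow[of k] that] pow[of "- k"]] by simp
  have trans: "pgl 1 x 0 1 \<in> ?H" for x
  proof (cases x)
    case (Golden a b)
    then show ?thesis using add[OF int[of a] conj[OF int[of b], of 1]] by (simp add: epow_1)
  qed
  have "pgl a b c d \<in> ?H" if "eps_det a b c d" for a b c d
    using that
  proof (induction "height c" arbitrary: a b c d rule: less_induct)
    case less
    obtain k where k: "a * d - b * c = epow k" using less.prems by (auto simp: eps_det_def)
    show ?case
    proof (cases "c = 0")
      case True
      then have ad: "a * d = epow k" using k by simp
      then have "height a * height d = 1" by (metis height_mult height_epow)
      then have "d \<in> units" by (simp add: height_1_imp_unit)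
      then obtain v where v: "v \<in> units" "v * d = 1" using units_inverse by metis
      obtain j where "v = epow j \<or> v = - epow j" using v(1) by (auto simp: units_def)
      then have vv: "v * v = epow (j + j)" unfolding epow_add by auto
      \<comment> \<open>Scaling makes the lower right entry 1. The upper left entry becomes a power
        of \<open>eps\<close> with positive sign because the determinant and the square of a unit
        are such powers; hence \<open>nu\<close> and translations suffice.\<close>
      have "v * a = (v * v) * (a * d)" using v(2) by algebra
      then have va: "v * a = epow (j + j + k)" unfolding vv ad by (simp only: epow_add)
      have "pgl (epow (j + j + k)) (v * b) 0 1 \<in> ?H"
        using mult[OF trans[of "v * b"] pow[of "j + j + k"]] by simp
      then show ?thesis
        using pgl_scale[OF v(1) less.prems] True v(2) by (simp only: va mult_zero_right)
    next
      case False
      obtain x where x: "height (d + x * c) < height c" using golden_euclid[OF False] by blast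
      let ?b = "b + x * a" and ?d = "d + x * c"
      have "- ?b * c - a * - ?d = epow k" unfolding k[symmetric] by (simp add: algebra_simps)
      then have det: "eps_det (- ?b) a (- ?d) c" unfolding eps_det_def by blast
      have "height (- ?d) < height c" using x by (simp only: height_uminus)
      from less.hyps[OF this det] have 1: "pgl (- ?b) a (- ?d) c \<in> ?H" .
      \<comment> \<open>Undoing the Euclidean step uses \<open>sigma\<close> itself in place of its
        inverse, which accounts for the sign removed at the end.\<close>
      have 2: "pgl (- a) (- ?b) (- c) (- ?d) \<in> ?H"
        using mult[OF 1 gens(1) det] by simp
      have "- a * - ?d - - ?b * - c = epow k" unfolding k[symmetric] by (simp add: algebra_simps)
      then have "eps_det (- a) (- ?b) (- c) (- ?d)" unfolding eps_det_def by blast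
      from mult[OF 2 trans[of "- x"] this] have "pgl (- a) (- b) (- c) (- d) \<in> ?H"
        by (simp add: algebra_simps)
      then show ?thesis using pgl_scale[OF units_uminus[OF one_in_units] less.prems] by simp
    qed
  qed
  then show "carrier Gamma_star \<subseteq> ?H" by (auto simp: carrier_Gamma_star)
qed

section \<open>The presentation\<close>

fun letter_value :: "('a, 'm) monoid_scheme \<Rightarrow> ('x \<Rightarrow> 'a) \<Rightarrow> bool \<times> 'x \<Rightarrow> 'a" where
  "letter_value G f (b, x) = (if b then f x else inv\<^bsub>G\<^esub> f x)"

definition word_value :: "('a, 'm) monoid_scheme \<Rightarrow> ('x \<Rightarrow> 'a) \<Rightarrow> 'x word \<Rightarrow> 'a" where
  "word_value G f w = foldr (\<lambda>l a. letter_value G f l \<otimes>\<^bsub>G\<^esub> a) w \<one>\<^bsub>G\<^esub>"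

context group
begin

lemma letter_value_closed:
  assumes "range f \<subseteq> carrier G"
  shows "letter_value G f l \<in> carrier G"
  using assms by (cases l) auto

lemma word_value_closed:
  assumes "range f \<subseteq> carrier G"
  shows "word_value G f w \<in> carrier G"
  by (induction w) (simp_all add: word_value_def letter_value_closed[OF assms])

lemma word_value_append:
  assumes "range f \<subseteq> carrier G"
  shows "word_value G f (u @ v) = word_value G f u \<otimes> word_value G f v"
  using word_value_closed[OF assms]
  by (induction u) (simp_all add: word_value_def letter_value_closed[OF assms] m_assoc)

lemma word_value_free_eq:
  assumes f: "range f \<subseteq> carrier G" and "(u, v) \<in> free_eq"
  shows "word_value G f u = word_value G f v"
proof -
  have cancel: "word_value G f a = word_value G f b" if ab: "(a, b) \<in> cancel_step" for a b
  proof -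
    obtain u v c x where uv: "a = u @ [(c, x), (\<not> c, x)] @ v" "b = u @ v"
      using ab unfolding cancel_step_def by blast
    have "f x \<in> carrier G" using f by auto
    then have "word_value G f [(c, x), (\<not> c, x)] = \<one>" by (simp add: word_value_def)
    then show ?thesis
      using word_value_closed[OF f] unfolding uv word_value_append[OF f] by simp
  qed
  show ?thesis
    using assms(2) unfolding free_eq_def
    by (induction rule: rtrancl_induct) (auto dest: cancel)
qed

lemma free_group_lift:
  fixes f :: "'x \<Rightarrow> 'a"
  assumes f: "range f \<subseteq> carrier G"
  obtains \<phi> where "\<phi> \<in> hom free_group G" "\<And>x. \<phi> (free_gen x) = f x"
proof
  \<comment> \<open>The choice of representative is harmless, as \<open>word_value\<close> is
    constant on classes.\<close>
  define \<phi> where "\<phi> A = word_value G f (SOME w. w \<in> A)" for A :: "'x word set"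
  have \<phi>: "\<phi> (free_eq `` {w}) = word_value G f w" for w
  proof -
    have "w \<in> free_eq `` {w}" using equiv_class_self[OF equiv_free_eq] by simp
    then have "(SOME v. v \<in> free_eq `` {w}) \<in> free_eq `` {w}" by (rule someI)
    then have "(w, SOME v. v \<in> free_eq `` {w}) \<in> free_eq" by simp
    from word_value_free_eq[OF f this] show ?thesis unfolding \<phi>_def by (rule sym)
  qed
  have cls: "\<exists>w. A = free_eq `` {w}" if A: "A \<in> carrier free_group" for A :: "'x word set"
    using A by (auto simp: free_group_def elim: quotientE)
  show "\<phi> \<in> hom free_group G"
  proof (rule homI)
    fix A B assume "A \<in> carrier (free_group :: 'x word set monoid)" "B \<in> carrier (free_group :: 'x word set monoid)"
    then obtain u v where "A = free_eq `` {u}" "B = free_eq `` {v}" using cls by metis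
    then show "\<phi> A \<in> carrier G" "\<phi> (A \<otimes>\<^bsub>free_group\<^esub> B) = \<phi> A \<otimes> \<phi> B"
      by (simp_all add: mult_free_group \<phi> word_value_append[OF f] word_value_closed[OF f])
  qed
  show "\<phi> (free_gen x) = f x" for x
    using f by (simp add: free_gen_def \<phi> word_value_def image_subset_iff)
qed

end

lemma free_group_class_closed: "free_eq `` {w} \<in> carrier free_group"
  by (simp add: free_group_def quotientI)

lemma free_gen_closed: "free_gen x \<in> carrier free_group"
  by (simp add: free_gen_def free_group_class_closed)

lemma inv_free_gen: "inv\<^bsub>free_group\<^esub> (free_gen x) = free_eq `` {[(False, x)]}"
proof (rule group.inv_equality[OF group_free_group])
  have "([(False, x), (True, x)], []) \<in> cancel_step"
    unfolding cancel_step_def by (auto intro!: exI[of _ "[]"])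
  then have "([(False, x), (True, x)], []) \<in> free_eq" unfolding free_eq_def by blast
  then show "free_eq `` {[(False, x)]} \<otimes>\<^bsub>free_group\<^esub> free_gen x = \<one>\<^bsub>free_group\<^esub>"
    unfolding free_gen_def mult_free_group using equiv_class_eq[OF equiv_free_eq]
    by (simp add: free_group_def)
qed (simp_all add: free_gen_def free_group_class_closed)

text \<open>Letters are split off on the right because the rules of \<open>D\<close> multiply on the
  right.\<close>

lemma hom_free_group_snoc:
  assumes "group H" "\<psi> \<in> hom free_group H"
  shows "\<psi> (free_eq `` {w @ [l]}) =
    \<psi> (free_eq `` {w}) \<otimes>\<^bsub>H\<^esub> letter_value H (\<lambda>x. \<psi> (free_gen x)) l"
proof -
  interpret group_hom free_group H \<psi>
    by (intro group_hom.intro group_hom_axioms.intro group_free_group assms)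
  have "free_eq `` {w @ [l]} = free_eq `` {w} \<otimes>\<^bsub>free_group\<^esub> free_eq `` {[l]}"
    by (simp add: mult_free_group)
  then have "\<psi> (free_eq `` {w @ [l]}) = \<psi> (free_eq `` {w}) \<otimes>\<^bsub>H\<^esub> \<psi> (free_eq `` {[l]})"
    by (simp add: free_group_class_closed)
  moreover have "\<psi> (free_eq `` {[l]}) = letter_value H (\<lambda>x. \<psi> (free_gen x)) l"
  proof (cases l)
    case (Pair b x)
    have "\<psi> (free_eq `` {[(False, x)]}) = inv\<^bsub>H\<^esub> \<psi> (free_gen x)"
      unfolding inv_free_gen[symmetric] by (rule hom_inv[OF free_gen_closed])
    then show ?thesis by (cases b) (simp_all add: Pair free_gen_def)
  qed
  ultimately show ?thesis by simp
qed

lemma relations_in_hom: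
  assumes "group_hom G H \<psi>" "s \<in> carrier G" "n \<in> carrier G" "t \<in> carrier G"
  shows "relations_in H (\<psi> s) (\<psi> n) (\<psi> t) = map_prod \<psi> \<psi> ` relations_in G s n t"
proof -
  interpret group_hom G H \<psi> by (rule assms(1))
  show ?thesis
    using assms(2-4) by (simp add: relations_in_def hom_nat_pow hom_int_pow)
qed

lemma Gamma_star_satisfies:
  assumes "(l, r) \<in> relations_in Gamma_star sigma nu tau"
  shows "l = r"
proof -
  note pm = pgl_mult eps_det_simps pgl_closed
  have e: "epow 1 * epow (- 1) = 1" "epow (- 1) * epow 1 = 1" by simp_all
  \<comment> \<open>The minimal equation of \<open>eps\<close>, which makes the two sides of (v')
    the same translation.\<close>
  have e2: "epow 1 * epow 1 = epow 1 + 1" by (simp add: epow_1 one_golden_def)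
  have det: "eps_det 0 1 (- epow 1) 0" "eps_det 0 1 (- 1) (- 1)"
    by (auto simp: eps_det_def intro: exI[of _ 0])
  have 1: "sigma [^]\<^bsub>Gamma_star\<^esub> (2::nat) = \<one>\<^bsub>Gamma_star\<^esub>"
    by (simp add: numeral_2_eq_2) (simp add: sigma_pgl pm pgl_unit units_uminus)
  have st: "sigma \<otimes>\<^bsub>Gamma_star\<^esub> tau = pgl 0 1 (- 1) (- 1)"
    by (simp add: sigma_pgl tau_pgl pm)
  have 2: "(sigma \<otimes>\<^bsub>Gamma_star\<^esub> tau) [^]\<^bsub>Gamma_star\<^esub> (3::nat) = \<one>\<^bsub>Gamma_star\<^esub>"
  proof -
    have "pgl 0 1 (- 1) (- 1) \<otimes>\<^bsub>Gamma_star\<^esub> pgl 0 1 (- 1) (- 1) = pgl (- 1) (- 1) 1 0"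
      by (simp add: pm det)
    moreover have "eps_det (- 1) (- 1) 1 0" by (auto simp: eps_det_def intro: exI[of _ 0])
    ultimately show ?thesis
      unfolding st by (simp add: numeral_3_eq_3 pm det) (simp add: pm det pgl_unit)
  qed
  have sn: "sigma \<otimes>\<^bsub>Gamma_star\<^esub> nu = pgl 0 1 (- epow 1) 0"
    by (simp add: sigma_pgl nu_pgl pm)
  have 3: "(sigma \<otimes>\<^bsub>Gamma_star\<^esub> nu) [^]\<^bsub>Gamma_star\<^esub> (2::nat) = \<one>\<^bsub>Gamma_star\<^esub>"
    unfolding sn by (simp add: numeral_2_eq_2 pm det) (simp add: pm det pgl_unit units_uminus)
  have tn: "tau \<otimes>\<^bsub>Gamma_star\<^esub> nu = pgl (epow 1) 1 0 1"
    by (simp add: tau_pgl nu_pgl pm)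
  have tnt: "pgl (epow 1) 1 0 1 \<otimes>\<^bsub>Gamma_star\<^esub> tau = pgl (epow 1) (epow 1 + 1) 0 1"
    by (simp add: tau_pgl pm)
  have tntn: "pgl (epow 1) (epow 1 + 1) 0 1 \<otimes>\<^bsub>Gamma_star\<^esub> inv\<^bsub>Gamma_star\<^esub> nu = pgl 1 (epow 1 + 1) 0 1"
    by (simp add: inv_nu pm e)
  note L = tn tnt tntn
  have nt: "nu \<otimes>\<^bsub>Gamma_star\<^esub> tau = pgl (epow 1) (epow 1) 0 1"
    by (simp add: tau_pgl nu_pgl pm)
  have ntn: "pgl (epow 1) (epow 1) 0 1 \<otimes>\<^bsub>Gamma_star\<^esub> inv\<^bsub>Gamma_star\<^esub> nu = pgl 1 (epow 1) 0 1"
    by (simp add: inv_nu pm e)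
  have ntnt: "pgl 1 (epow 1) 0 1 \<otimes>\<^bsub>Gamma_star\<^esub> tau = pgl 1 (epow 1 + 1) 0 1"
    by (simp add: tau_pgl pm add.commute)
  have nn: "nu [^]\<^bsub>Gamma_star\<^esub> (2::nat) = pgl (epow 2) 0 0 1"
    by (simp add: numeral_2_eq_2) (simp add: nu_pgl pm flip: epow_add)
  have n2: "nu [^]\<^bsub>Gamma_star\<^esub> (- 2::int) = pgl (epow (- 2)) 0 0 1"
  proof -
    have "nu [^]\<^bsub>Gamma_star\<^esub> (- 2::int) = inv\<^bsub>Gamma_star\<^esub> pgl (epow 2) 0 0 1"
      using Gamma_star.int_pow_neg_int[of nu 2] nn by simp
    also have "\<dots> = pgl (epow (- 2)) 0 0 1"
      by (rule Gamma_star.inv_equality) (simp_all add: pm pgl_unit)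
    finally show ?thesis .
  qed
  have e22: "epow 2 = epow 1 + 1" using epow_add[of 1 1] e2 by simp
  have 5: "nu [^]\<^bsub>Gamma_star\<^esub> (2::nat) \<otimes>\<^bsub>Gamma_star\<^esub> tau \<otimes>\<^bsub>Gamma_star\<^esub> nu [^]\<^bsub>Gamma_star\<^esub> (- 2::int)
      = pgl 1 (epow 1 + 1) 0 1"
    unfolding nn n2 by (simp add: tau_pgl pm) (simp add: e22)
  show ?thesis
    using assms 1 2 3 5 by (auto simp: relations_in_def L nt ntn ntnt)
qed

interpretation Gamma_star_rel: hilbert_relations Gamma_star sigma nu tau
  by (intro hilbert_relations.intro hilbert_relations_axioms.intro group_Gamma_star)
    (simp_all add: Gamma_star_satisfies)

lemma range_generator_image: "range generator_image \<subseteq> carrier Gamma_star"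
  by (auto simp: generator_image_def split: generator.splits)

context hilbert_relations
begin

text \<open>Follows the two evaluations of one word in parallel: the abstract one in
  \<open>G\<close> and the concrete one by matrices. Every letter acts by one of the rules of
  \<open>D\<close>, except \<open>s\<close>, for which \<open>D_s\<close> is needed.\<close>

lemma D_word:
  assumes \<psi>: "\<psi> \<in> hom free_group G" "\<psi> (free_gen Sigma_gen) = s" "\<psi> (free_gen Nu_gen) = n"
      "\<psi> (free_gen Tau_gen) = t"
    and \<phi>: "\<phi> \<in> hom free_group Gamma_star" "\<And>x. \<phi> (free_gen x) = generator_image x"
  shows "\<exists>a b c d. D (\<psi> (free_eq `` {w})) a b c d \<and> eps_det a b c d \<and>
    \<phi> (free_eq `` {w}) = pgl a b c d"
proof (induction w rule: rev_induct)
  case Nil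
  have one: "free_eq `` {[]} = \<one>\<^bsub>free_group\<^esub>" by (simp add: free_group_def)
  have "\<psi> (free_eq `` {[]}) = \<one>" "\<phi> (free_eq `` {[]}) = \<one>\<^bsub>Gamma_star\<^esub>"
    unfolding one using hom_one[OF \<psi>(1)] hom_one[OF \<phi>(1)] group_free_group is_group group_Gamma_star
    by blast+
  then show ?case
    using D.one pgl_unit[of 1]
    by (intro exI[of _ 1] exI[of _ 0]) (simp add: eps_det_unit_scalar)
next
  case (snoc l w)
  let ?g = "\<psi> (free_eq `` {w})"
  from snoc obtain a b c d where D: "D ?g a b c d" and det: "eps_det a b c d"
    and p: "\<phi> (free_eq `` {w}) = pgl a b c d" by blast
  note snoc_hom = hom_free_group_snoc[OF is_group \<psi>(1)] hom_free_group_snoc[OF group_Gamma_star \<phi>(1)]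
  have fin: ?case
    if "letter_value G (\<lambda>x. \<psi> (free_gen x)) l = g"
      "letter_value Gamma_star (\<lambda>x. \<phi> (free_gen x)) l = pgl a' b' c' d'" "eps_det a' b' c' d'"
      "D (?g \<otimes> g) (a * a' + b * c') (a * b' + b * d') (c * a' + d * c') (c * b' + d * d')"
    for g a' b' c' d'
    using that eps_det_mult[OF det that(3)] pgl_mult[OF det that(3)]
    unfolding snoc_hom p by metis
  obtain e x where l: "l = (e, x)" by (cases l)
  have s: "D (?g \<otimes> s) (- b) a (- d) c" by (rule D_s[OF D])
  have T: "D (?g \<otimes> T y) a (b + y * a) c (d + y * c)" for y by (rule D.trans[OF D])
  have N: "D (?g \<otimes> n [^] k) (epow k * a) b (epow k * c) d" for k :: int by (rule D.pow_n[OF D])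
  show ?case
  proof (cases x)
    \<comment> \<open>Both \<open>s\<close> and \<open>sigma\<close> are involutions, so the letter
      and its inverse have the same values.\<close>
    case Sigma_gen
    show ?thesis
      by (rule fin[of s 0 1 "- 1" 0])
        (use s in \<open>simp_all add: l Sigma_gen \<psi> \<phi> generator_image_def sigma_pgl[symmetric]\<close>)
  next
    case Nu_gen
    show ?thesis
    proof (cases e)
      case True
      show ?thesis
        by (rule fin[of n "epow 1" 0 0 1])
          (use N[of 1] in \<open>simp_all add: l Nu_gen True \<psi> \<phi> generator_image_def nu_pgl mult.commute\<close>)
    next
      case False
      have "n [^] (- 1 :: int) = inv n" by (simp add: int_pow_neg)
      then show ?thesis
        by (intro fin[of "inv n" "epow (- 1)" 0 0 1])
          (use N[of "- 1"] in \<open>simp_all add: l Nu_gen False \<psi> \<phi> generator_image_def inv_nu mult.commute\<close>)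
    qed
  next
    case Tau_gen
    show ?thesis
    proof (cases e)
      case True
      show ?thesis
        by (rule fin[of t 1 1 0 1])
          (use T[of 1] in \<open>simp_all add: l Tau_gen True \<psi> \<phi> generator_image_def tau_pgl add.commute\<close>)
    next
      case False
      show ?thesis
        by (rule fin[of "inv t" 1 "- 1" 0 1])
          (use T[of "- 1"] in \<open>simp_all add: l Tau_gen False \<psi> \<phi> generator_image_def inv_tau T_minus_1\<close>)
    qed
  qed
qed

lemma kernel_word_trivial:
  assumes "\<psi> \<in> hom free_group G" "\<psi> (free_gen Sigma_gen) = s" "\<psi> (free_gen Nu_gen) = n"
      "\<psi> (free_gen Tau_gen) = t"
    and "\<phi> \<in> hom free_group Gamma_star" "\<And>x. \<phi> (free_gen x) = generator_image x"
    and A: "A \<in> kernel free_group Gamma_star \<phi>"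
  shows "\<psi> A = \<one>"
proof -
  obtain w where w: "A = free_eq `` {w}"
    using A by (auto simp: kernel_def free_group_def elim: quotientE)
  obtain a b c d where D: "D (\<psi> A) a b c d" and "\<phi> A = pgl a b c d"
    using D_word[OF assms(1-6)] w by metis
  then have "pgl a b c d = \<one>\<^bsub>Gamma_star\<^esub>" using A by (simp add: kernel_def)
  then have "b = 0 \<and> c = 0 \<and> a = d" by (rule pgl_eq_one)
  then show ?thesis using D D_scalar_imp_one by auto
qed

end

text \<open>Modulo \<open>N\<close> the generators satisfy the five relations, so a word that is
  trivial in \<open>Gamma_star\<close> is trivial in the quotient, which says that it lies in
  \<open>N\<close>.\<close>

lemma kernel_subset_normal:
  assumes \<phi>: "\<phi> \<in> hom free_group Gamma_star" "\<And>x. \<phi> (free_gen x) = generator_image x"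
    and N: "N \<lhd> free_group" "relators Gamma_star_relations \<subseteq> N"
  shows "kernel free_group Gamma_star \<phi> \<subseteq> N"
proof
  fix A assume A: "A \<in> kernel free_group Gamma_star \<phi>"
  let ?q = "\<lambda>x. N #>\<^bsub>free_group\<^esub> x"
  interpret F: group "free_group :: generator word set monoid" by (rule group_free_group)
  have sub: "subgroup N free_group" using N(1) by (rule normal_imp_subgroup)
  have q: "?q \<in> hom free_group (free_group Mod N)" by (rule normal.r_coset_hom_Mod[OF N(1)])
  have grp: "group (free_group Mod N)" by (rule normal.factorgroup_is_group[OF N(1)])
  have gh: "group_hom free_group (free_group Mod N) ?q"
    by (intro group_hom.intro group_hom_axioms.intro F.is_group grp q)
  have rel: "l = r"
    if lr: "(l, r) \<in> relations_in (free_group Mod N) (?q (free_gen Sigma_gen)) (?q (free_gen Nu_gen))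
      (?q (free_gen Tau_gen))" for l r
  proof -
    obtain l' r' where *: "(l', r') \<in> Gamma_star_relations" "l = ?q l'" "r = ?q r'"
      using lr unfolding relations_in_hom[OF gh free_gen_closed free_gen_closed free_gen_closed]
        Gamma_star_relations_def[symmetric] by auto
    have c: "l' \<in> carrier free_group" "r' \<in> carrier free_group"
      using *(1) by (auto simp: Gamma_star_relations_def relations_in_def free_gen_closed)
    have "l' \<otimes>\<^bsub>free_group\<^esub> inv\<^bsub>free_group\<^esub> r' \<in> N"
      using N(2) *(1) by (auto simp: relators_def)
    then have "l' \<in> ?q r'"
      using c subgroup.rcos_module_rev[OF sub F.is_group] by blast
    then show ?thesis unfolding * using F.repr_independence[OF _ c(2) sub] by blast
  qed
  interpret Q: hilbert_relations "free_group Mod N" "?q (free_gen Sigma_gen)" "?q (free_gen Nu_gen)"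
      "?q (free_gen Tau_gen)"
    by (intro hilbert_relations.intro hilbert_relations_axioms.intro grp rel
      hom_in_carrier[OF q free_gen_closed])
  have "?q A = \<one>\<^bsub>free_group Mod N\<^esub>"
    by (rule Q.kernel_word_trivial[OF q _ _ _ \<phi> A]) auto
  then have "?q A = N" by simp
  moreover have "A \<in> carrier free_group" using A by (simp add: kernel_def)
  ultimately show "A \<in> N" using F.rcos_self[OF _ sub] by blast
qed

theorem theorem6p1:
  shows "generate Gamma_star {sigma, nu, tau} = carrier Gamma_star \<and>
    defining_relations Gamma_star generator_image Gamma_star_relations"
proof
  show "generate Gamma_star {sigma, nu, tau} = carrier Gamma_star"
    by (rule Gamma_star_generated)
  obtain \<phi> where \<phi>: "\<phi> \<in> hom free_group Gamma_star" "\<And>x. \<phi> (free_gen x) = generator_image x"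
    using Gamma_star.free_group_lift[OF range_generator_image] by blast
  interpret h: group_hom free_group Gamma_star \<phi>
    by (intro group_hom.intro group_hom_axioms.intro group_free_group group_Gamma_star \<phi>)
  have "relators Gamma_star_relations \<subseteq> kernel free_group Gamma_star \<phi>"
  proof
    fix A assume "A \<in> relators Gamma_star_relations"
    then obtain l r where A: "A = l \<otimes>\<^bsub>free_group\<^esub> inv\<^bsub>free_group\<^esub> r"
      and lr: "(l, r) \<in> Gamma_star_relations" by (auto simp: relators_def)
    have c: "l \<in> carrier free_group" "r \<in> carrier free_group"
      using lr by (auto simp: Gamma_star_relations_def relations_in_def free_gen_closed)
    have "(\<phi> l, \<phi> r) \<in> relations_in Gamma_star sigma nu tau"
      using relations_in_hom[OF h.group_hom_axioms free_gen_closed free_gen_closed free_gen_closed,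
          of Sigma_gen Nu_gen Tau_gen] lr
      by (auto simp: \<phi>(2) generator_image_def Gamma_star_relations_def)
    then have "\<phi> l = \<phi> r" by (rule Gamma_star_satisfies)
    then show "A \<in> kernel free_group Gamma_star \<phi>" using c by (simp add: kernel_def A)
  qed
  \<comment> \<open>The kernel is itself one of the normal subgroups being intersected, and it is
    contained in all the others.\<close>
  then have "kernel free_group Gamma_star \<phi> = normal_closure free_group (relators Gamma_star_relations)"
    unfolding normal_closure_def using h.normal_kernel kernel_subset_normal[OF \<phi>] by blast
  then show "defining_relations Gamma_star generator_image Gamma_star_relations"
    unfolding defining_relations_def using \<phi> by blast
qed

end
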